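(* On the Euler graph, let $\mu$ be an ergodic probability measure on the path space such that for every $n$, $\mathcal{L}(\varepsilon_n\mid V_{n-1})=\mathcal{L}(\varepsilon_n\mid\mathcal{G}_{n-1})$. Then the filtration $\mathcal{G}$ admits a generating parameterization; hence it is standard.
   Context: Euler graph: at each level $n\le0$ vertices $0,\dots,|n|$; vertex $v$ at level $n$ is connected to vertex $v$ at level $n-1$ by $v+1$ edges and to vertex $v+1$ at level $n-1$ by $|n|+1-v$ edges. Edges from a given vertex of level $n-1$ to level $n$ carry distinct labels. For a random path, $V_n$ is its vertex at level $n$ and $\varepsilon_n$ the label of its edge joining $V_{n-1}$ to $V_n$; $\mathcal G$ is the filtration generated by $(V_n,\varepsilon_n)_{n\le0}$, $\mathcal G_n=\sigma(V_m,\varepsilon_m;m\le n)$. $\mu$ is ergodic if $\bigcap_n\mathcal G_n$ is trivial. Parameterization of $\mathcal G$: $(U_n)$ with $U_n$ independent of $\mathcal G_{n-1}\vee\sigma(U_m;m\le n-1)$ and $\mathcal G_n\subset\mathcal G_{n-1}\vee\sigma(U_n)$; generating if $\mathcal G_n\subset\sigma(U_m;m\le n)$ for all $n$ (up to isomorphism). Standard: up to isomorphism, immersed in a filtration generated by independent random variables. *)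

theory Defs
  imports "HOL-Probability.Probability" "HOL-Probability.Conditional_Expectation"
begin

text \<open>Euler graph. Level n \<le> 0 is encoded by k = -n :: nat. At level k the vertices are 0..k.
  The edge joining vertex u at level k+1 (i.e. n-1) to vertex v at level k (i.e. n):
  if u = v there are v+1 parallel edges, if u = v+1 there are k+1-v parallel edges.
  A path is given by vertex sequence v and copy indices e; e k < (number of parallel
  edges) indexes the edge used between levels k+1 and k. The label of that edge is the
  pair (v k, e k): labels of edges leaving a given vertex of level k+1 are distinct.\<close>

definition euler_edge :: "nat \<Rightarrow> nat \<Rightarrow> nat \<Rightarrow> nat \<Rightarrow> bool" where
  "euler_edge k v u e \<longleftrightarrow> v \<le> k \<and> ((u = v \<and> e < v + 1) \<or> (u = Suc v \<and> e < k + 1 - v))"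

definition euler_path :: "(nat \<Rightarrow> nat) \<Rightarrow> (nat \<Rightarrow> nat) \<Rightarrow> bool" where
  "euler_path v e \<longleftrightarrow> (\<forall>k. euler_edge k (v k) (v (Suc k)) (e k))"

definition nat_events :: "'a measure \<Rightarrow> ('a \<Rightarrow> nat) \<Rightarrow> 'a set set" where
  "nat_events M X = {X -` A \<inter> space M | A. True}"

definition real_events :: "'a measure \<Rightarrow> ('a \<Rightarrow> real) \<Rightarrow> 'a set set" where
  "real_events M X = {X -` A \<inter> space M | A. A \<in> sets borel}"

text \<open>G_k = sigma(V_j, eps_j : j \<ge> k) with eps_j = (V_j, E_j) (i.e. G_n, n = -k).\<close>
definition Gfilt :: "'a measure \<Rightarrow> (nat \<Rightarrow> 'a \<Rightarrow> nat) \<Rightarrow> (nat \<Rightarrow> 'a \<Rightarrow> nat) \<Rightarrow> nat \<Rightarrow> 'a measure" where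
  "Gfilt M V E k = sigma (space M) (\<Union>j\<in>{k..}. nat_events M (V j) \<union> nat_events M (E j))"

definition Vgen :: "'a measure \<Rightarrow> (nat \<Rightarrow> 'a \<Rightarrow> nat) \<Rightarrow> nat \<Rightarrow> 'a measure" where
  "Vgen M V k = sigma (space M) (nat_events M (V k))"

definition Ufilt :: "'a measure \<Rightarrow> (nat \<Rightarrow> 'a \<Rightarrow> real) \<Rightarrow> nat \<Rightarrow> 'a measure" where
  "Ufilt M U k = sigma (space M) (\<Union>j\<in>{k..}. real_events M (U j))"

definition subalg_null :: "'a measure \<Rightarrow> 'a measure \<Rightarrow> 'a measure \<Rightarrow> bool" where
  "subalg_null M F H \<longleftrightarrow> (\<forall>A\<in>sets F. \<exists>B\<in>sets H. (A - B) \<union> (B - A) \<in> null_sets M)"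

definition path_law :: "'a measure \<Rightarrow> (nat \<Rightarrow> 'a \<Rightarrow> nat) \<Rightarrow> (nat \<Rightarrow> 'a \<Rightarrow> nat) \<Rightarrow> (nat \<Rightarrow> nat \<times> nat) measure" where
  "path_law M V E = distr M (PiM UNIV (\<lambda>_. count_space UNIV)) (\<lambda>\<omega>. \<lambda>k. (V k \<omega>, E k \<omega>))"

definition random_euler_path :: "'a measure \<Rightarrow> (nat \<Rightarrow> 'a \<Rightarrow> nat) \<Rightarrow> (nat \<Rightarrow> 'a \<Rightarrow> nat) \<Rightarrow> bool" where
  "random_euler_path M V E \<longleftrightarrow> prob_space M \<and>
     (\<forall>k. V k \<in> measurable M (count_space UNIV) \<and> E k \<in> measurable M (count_space UNIV)) \<and>
     (AE \<omega> in M. euler_path (\<lambda>k. V k \<omega>) (\<lambda>k. E k \<omega>))"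

definition ergodic_path :: "'a measure \<Rightarrow> (nat \<Rightarrow> 'a \<Rightarrow> nat) \<Rightarrow> (nat \<Rightarrow> 'a \<Rightarrow> nat) \<Rightarrow> bool" where
  "ergodic_path M V E \<longleftrightarrow>
     (\<forall>A. (\<forall>k. A \<in> sets (Gfilt M V E k)) \<longrightarrow> measure M A = 0 \<or> measure M A = 1)"

definition is_parameterization ::
  "'a measure \<Rightarrow> (nat \<Rightarrow> 'a \<Rightarrow> nat) \<Rightarrow> (nat \<Rightarrow> 'a \<Rightarrow> nat) \<Rightarrow> (nat \<Rightarrow> 'a \<Rightarrow> real) \<Rightarrow> bool" where
  "is_parameterization M V E U \<longleftrightarrow>
     (\<forall>k. U k \<in> borel_measurable M) \<and>
     (\<forall>k. prob_space.indep_set M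
            (sets (sigma (space M) (sets (Gfilt M V E (Suc k)) \<union> (\<Union>j\<in>{Suc k..}. real_events M (U j)))))
            (real_events M (U k))) \<and>
     (\<forall>k. subalg_null M (Gfilt M V E k) (sigma (space M) (sets (Gfilt M V E (Suc k)) \<union> real_events M (U k))))"

definition is_generating :: "'a measure \<Rightarrow> (nat \<Rightarrow> 'a \<Rightarrow> nat) \<Rightarrow> (nat \<Rightarrow> 'a \<Rightarrow> nat) \<Rightarrow> (nat \<Rightarrow> 'a \<Rightarrow> real) \<Rightarrow> bool" where
  "is_generating M V E U \<longleftrightarrow> (\<forall>k. subalg_null M (Gfilt M V E k) (Ufilt M U k))"

text \<open>Martingale for a (reverse-indexed) filtration F: X k is the value at time n = -k.\<close>
definition martingale_rev :: "'a measure \<Rightarrow> (nat \<Rightarrow> 'a measure) \<Rightarrow> (nat \<Rightarrow> 'a \<Rightarrow> real) \<Rightarrow> bool" where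
  "martingale_rev M F X \<longleftrightarrow>
     (\<forall>k. integrable M (X k) \<and> X k \<in> borel_measurable (F k)) \<and>
     (\<forall>k. AE \<omega> in M. real_cond_exp M (F (Suc k)) (X k) \<omega> = X (Suc k) \<omega>)"

definition immersed :: "'a measure \<Rightarrow> (nat \<Rightarrow> 'a measure) \<Rightarrow> (nat \<Rightarrow> 'a measure) \<Rightarrow> bool" where
  "immersed M G F \<longleftrightarrow> (\<forall>k. subalg_null M (G k) (F k)) \<and>
     (\<forall>X. martingale_rev M G X \<longrightarrow> (\<forall>k. AE \<omega> in M. real_cond_exp M (F (Suc k)) (X k) \<omega> = X (Suc k) \<omega>))"

text \<open>Copies live on a fixed canonical space (path coordinates and parameter coordinates).\<close>
type_synonym cspace = "(nat \<Rightarrow> nat \<times> nat) \<times> (nat \<Rightarrow> real)"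

definition standard_G :: "'a measure \<Rightarrow> (nat \<Rightarrow> 'a \<Rightarrow> nat) \<Rightarrow> (nat \<Rightarrow> 'a \<Rightarrow> nat) \<Rightarrow> bool" where
  "standard_G M V E \<longleftrightarrow>
     (\<exists>(N :: cspace measure) V' E' U. prob_space N \<and>
        (\<forall>k. V' k \<in> measurable N (count_space UNIV) \<and> E' k \<in> measurable N (count_space UNIV)) \<and>
        path_law N V' E' = path_law M V E \<and>
        (\<forall>k. U k \<in> borel_measurable N) \<and>
        prob_space.indep_vars N (\<lambda>_. borel) U UNIV \<and>
        immersed N (Gfilt N V' E') (Ufilt N U))"

end

theory Submission
  imports Defs
begin

text \<open>Given the vertex \<open>u\<close> of level \<open>k+1\<close>, the next edge has a law \<open>p k u\<close>. Draw independent edges for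
  all the vertices of level \<open>k+1\<close> and then replace the one drawn at the current vertex by the edge of the
  path: the resulting parameter \<open>U k\<close> is independent of the past and determines the next edge.
  A step changes the vertex by at most one and only downwards, so that two paths driven by the same
  parameters never cross. Hence, for a monotone function \<open>h\<close> of the vertex, the mean of
  \<open>\<bar>h V - h Y\<bar>\<close> for the given path \<open>V\<close> and a path \<open>Y\<close> driven by the parameters from a fixed vertex
  of a remote level \<open>K\<close> equals the mean deviation of \<open>E(h V | V\<^sub>K)\<close> from its value at that vertex. By
  ergodicity this reverse martingale converges to a constant, so \<open>V\<close> is a limit of functions of the
  parameters. Martingales of the path stay martingales in the larger filtration, because the auxiliary
  draws are independent of the path.\<close>

section \<open>Events up to null sets\<close>

text \<open>Tail triviality alone does not make a parameterization generating: paths driven by the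
  same parameters from different remote vertices might stay apart forever. What excludes this is
  order. For monotone \<open>h\<close> the $L^1$ distance between the two paths is carried from one
  level to the next with equality, \<open>h\<close> being replaced by its one-step transition, so
  that no contraction rate is needed and convergence of the reverse martingale is enough. Single
  vertices are not monotone events, but upper sets \<open>{x..}\<close> are, and they separate the
  vertices. All edges of a level are drawn at once because the parameter must be independent of the
  current vertex and yet be readable from every vertex. The inclusions of sigma-algebras hold only
  up to null sets. They are phrased through a null completion, which is a genuine sigma-algebra, so
  that the usual closure rules of measurable functions apply.\<close>

definition null_completion :: "'a measure \<Rightarrow> 'a measure \<Rightarrow> 'a measure" where
  "null_completion M H = sigma (space M)
     {A \<in> sets M. \<exists>B\<in>sets H. (A - B) \<union> (B - A) \<in> null_sets M}"

lemma space_null_completion [simp]: "space (null_completion M H) = space M"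
  by (simp add: null_completion_def space_measure_of_conv)

text \<open>Complements keep the symmetric difference and countable unions of null sets are null, so
  the generating family is already a sigma-algebra and generation adds nothing.\<close>

lemma sets_null_completion:
  assumes H: "subalgebra M H"
  shows "sets (null_completion M H) = {A \<in> sets M. \<exists>B\<in>sets H. (A - B) \<union> (B - A) \<in> null_sets M}"
    (is "_ = ?C")
proof -
  have HM: "sets H \<subseteq> sets M" and sp: "space H = space M"
    using H by (auto simp: subalgebra_def)
  have "sigma_algebra (space M) ?C"
  proof (rule sigma_algebra_iff2[THEN iffD2], intro conjI ballI allI impI)
    show "?C \<subseteq> Pow (space M)" using sets.space_closed by auto
    show "{} \<in> ?C" by (auto intro!: bexI[of _ "{}"])
    show "space M - A \<in> ?C" if A: "A \<in> ?C" for A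
    proof -
      obtain B where B: "B \<in> sets H" "(A - B) \<union> (B - A) \<in> null_sets M" using A by auto
      have "A \<subseteq> space M" "B \<subseteq> space M"
        using A B sets.sets_into_space sp by auto
      then have "(space M - A - (space M - B)) \<union> (space M - B - (space M - A)) = (A - B) \<union> (B - A)"
        by auto
      moreover have "space M - B \<in> sets H" using B(1) sp by (metis sets.compl_sets)
      moreover have "space M - A \<in> sets M" using A by auto
      ultimately show ?thesis using B(2) by (intro CollectI conjI bexI[of _ "space M - B"]) auto
    qed
    show "(\<Union>i. A i) \<in> ?C" if A: "range A \<subseteq> ?C" for A :: "nat \<Rightarrow> 'a set"
    proof -
      have "\<forall>i. \<exists>B. B \<in> sets H \<and> (A i - B) \<union> (B - A i) \<in> null_sets M" using A by blast
      then obtain B where B: "\<And>i. B i \<in> sets H" "\<And>i. (A i - B i) \<union> (B i - A i) \<in> null_sets M"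
        by metis
      have AM: "A i \<in> sets M" for i using A by auto
      have BM: "B i \<in> sets M" for i using B HM by auto
      have "(\<Union>i. (A i - B i) \<union> (B i - A i)) \<in> null_sets M"
        using B(2) by (intro null_sets_UN) auto
      then have "((\<Union>i. A i) - (\<Union>i. B i)) \<union> ((\<Union>i. B i) - (\<Union>i. A i)) \<in> null_sets M"
        by (rule null_sets_subset) (use AM BM in auto)
      moreover have "(\<Union>i. B i) \<in> sets H" using B by auto
      ultimately show ?thesis using AM by blast
    qed
  qed
  moreover have "?C \<subseteq> Pow (space M)" using sets.space_closed by auto
  ultimately show ?thesis
    unfolding null_completion_def by (simp add: sigma_algebra.sigma_sets_eq)
qed

text \<open>Turns the existential notion into a plain inclusion, which can then be proved by
  measurability of the generating coordinates.\<close>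

lemma subalg_null_iff_null_completion:
  assumes "subalgebra M H" "sets F \<subseteq> sets M"
  shows "subalg_null M F H \<longleftrightarrow> sets F \<subseteq> sets (null_completion M H)"
  using assms by (auto simp: subalg_null_def sets_null_completion)

lemma sets_subset_null_completion:
  "subalgebra M H \<Longrightarrow> sets H \<subseteq> sets (null_completion M H)"
  by (auto simp: sets_null_completion subalgebra_def intro!: bexI)

lemma measurable_null_completionI:
  "subalgebra M H \<Longrightarrow> X \<in> measurable H S \<Longrightarrow> X \<in> measurable (null_completion M H) S"
  using sets_subset_null_completion[of M H]
  by (auto simp: measurable_def subalgebra_def)

lemma measurable_null_completion_mono:
  assumes "subalgebra M H" "subalgebra M H'" "sets H \<subseteq> sets H'"
    and "X \<in> measurable (null_completion M H) S"
  shows "X \<in> measurable (null_completion M H') S"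
  using assms by (auto simp: measurable_def sets_null_completion) blast

lemma sets_null_completion_AE_cong:
  assumes H: "subalgebra M H" and A: "A \<in> sets (null_completion M H)" "A' \<in> sets M"
    and eq: "AE x in M. x \<in> A \<longleftrightarrow> x \<in> A'"
  shows "A' \<in> sets (null_completion M H)"
proof -
  obtain B where B: "B \<in> sets H" "(A - B) \<union> (B - A) \<in> null_sets M" and AM: "A \<in> sets M"
    using A H by (auto simp: sets_null_completion)
  have BM: "B \<in> sets M" using B H by (auto simp: subalgebra_def)
  have "AE x in M. x \<notin> (A - B) \<union> (B - A)"
    using B(2) by (rule AE_not_in)
  with eq have "AE x in M. x \<notin> (A' - B) \<union> (B - A')" by eventually_elim auto
  then have "(A' - B) \<union> (B - A') \<in> null_sets M"
    using A(2) BM by (subst (asm) AE_iff_null_sets[symmetric]) auto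
  with A B H show ?thesis by (auto simp: sets_null_completion)
qed

lemma measurable_null_completion_AE_cong:
  assumes H: "subalgebra M H" and X: "X \<in> measurable (null_completion M H) S"
    and Y: "Y \<in> measurable M S" and eq: "AE x in M. X x = Y x"
  shows "Y \<in> measurable (null_completion M H) S"
proof (rule measurableI)
  show "x \<in> space (null_completion M H) \<Longrightarrow> Y x \<in> space S" for x
    using Y by (auto dest: measurable_space)
  fix A assume A: "A \<in> sets S"
  have "AE x in M. x \<in> X -` A \<inter> space M \<longleftrightarrow> x \<in> Y -` A \<inter> space M"
    using eq by eventually_elim auto
  with measurable_sets[OF X A] measurable_sets[OF Y A]
  show "Y -` A \<inter> space (null_completion M H) \<in> sets (null_completion M H)"
    by (auto intro: sets_null_completion_AE_cong[OF H])
qed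

text \<open>With errors below $(1/2)^i$, Borel-Cantelli leaves almost every point in finitely many
  symmetric differences only. Hence \<open>A\<close> agrees almost surely with the lower limit of
  the approximating events, which belongs to \<open>H\<close>.\<close>

lemma (in prob_space) null_completionI_approx:
  assumes H: "subalgebra M H" and A: "A \<in> events"
    and approx: "\<And>e. e > 0 \<Longrightarrow> \<exists>B\<in>sets H. prob ((A - B) \<union> (B - A)) < e"
  shows "A \<in> sets (null_completion M H)"
proof -
  have "\<exists>B\<in>sets H. prob ((A - B) \<union> (B - A)) < (1/2)^i" for i :: nat
    by (rule approx) simp
  then obtain B where B: "\<And>i. B i \<in> sets H" "\<And>i. prob ((A - B i) \<union> (B i - A)) < (1/2)^i"
    by metis
  have BM: "B i \<in> events" for i using B H by (auto simp: subalgebra_def)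
  define D where "D i = (A - B i) \<union> (B i - A)" for i
  have D: "D i \<in> events" for i unfolding D_def using A BM by auto
  have "AE x in M. eventually (\<lambda>i. x \<in> space M - D i) sequentially"
  proof (rule borel_cantelli_AE1)
    show "D i \<in> events" for i by (rule D)
    show "emeasure M (D i) < \<infinity>" for i by (simp add: less_top[symmetric])
    show "summable (\<lambda>i. measure M (D i))"
      by (rule summable_comparison_test'[where N=0 and g="\<lambda>i. (1/2)^i"])
        (use B(2) in \<open>auto simp: D_def less_imp_le\<close>)
  qed
  then have ev: "AE x in M. x \<in> A \<longleftrightarrow> x \<in> (\<Union>n. \<Inter>i\<in>{n..}. B i)"
  proof eventually_elim
    case (elim x)
    then obtain n where n: "\<And>i. i \<ge> n \<Longrightarrow> x \<notin> D i" by (auto simp: eventually_sequentially)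
    then have n: "x \<in> A \<longleftrightarrow> x \<in> B i" if "i \<ge> n" for i using that by (auto simp: D_def)
    show ?case
    proof
      assume "x \<in> A" then show "x \<in> (\<Union>n. \<Inter>i\<in>{n..}. B i)" using n by auto
    next
      assume "x \<in> (\<Union>n. \<Inter>i\<in>{n..}. B i)"
      then obtain m where "\<And>i. i \<ge> m \<Longrightarrow> x \<in> B i" by auto
      then have "x \<in> B (max m n)" by simp
      then show "x \<in> A" using n[of "max m n"] by simp
    qed
  qed
  have "(\<Union>n. \<Inter>i\<in>{n..}. B i) \<in> sets H"
    using B(1) by (intro sets.countable_UN sets.countable_INT'') auto
  then have "(\<Union>n. \<Inter>i\<in>{n..}. B i) \<in> sets (null_completion M H)"
    using sets_subset_null_completion[OF H] by auto
  then show ?thesis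
    by (rule sets_null_completion_AE_cong[OF H _ A]) (use ev in auto)
qed

lemma (in prob_space) sigma_finite_subalgebraI: "subalgebra M F \<Longrightarrow> sigma_finite_subalgebra M F"
  by (intro finite_measure_subalgebra_is_sigma_finite finite_measure_subalgebra.intro
      finite_measure_subalgebra_axioms.intro) (rule finite_measure_axioms)

text \<open>The version for \<open>H\<close> also serves \<open>J\<close>: in the defining integrals
  each event of \<open>J\<close> may be exchanged for an event of \<open>H\<close> that differs from
  it by a null set.\<close>

lemma (in prob_space) real_cond_exp_null_completion:
  assumes H: "subalgebra M H" and J: "subalgebra M J" and HJ: "sets H \<subseteq> sets J"
    and null: "sets J \<subseteq> sets (null_completion M H)" and f: "integrable M f"
  shows "AE x in M. real_cond_exp M H f x = real_cond_exp M J f x"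
proof -
  interpret H: sigma_finite_subalgebra M H by (rule sigma_finite_subalgebraI[OF H])
  interpret J: sigma_finite_subalgebra M J by (rule sigma_finite_subalgebraI[OF J])
  have "AE x in M. real_cond_exp M J f x = real_cond_exp M H f x"
  proof (rule J.real_cond_exp_charact)
    show "integrable M f" by fact
    show "integrable M (real_cond_exp M H f)" by (rule H.real_cond_exp_int[OF f])
    have "subalgebra J H" using H J HJ by (auto simp: subalgebra_def)
    then show "real_cond_exp M H f \<in> borel_measurable J"
      by (rule measurable_from_subalg) simp
    fix A assume A: "A \<in> sets J"
    then obtain B where B: "B \<in> sets H" "(A - B) \<union> (B - A) \<in> null_sets M"
      using null H by (auto simp: sets_null_completion)
    have AM: "A \<in> events" and BM: "B \<in> events"
      using A B H J by (auto simp: subalgebra_def)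
    have "AE x in M. x \<notin> (A - B) \<union> (B - A)" by (rule AE_not_in[OF B(2)])
    then have AB: "AE x in M. indicator A x = (indicator B x :: real)"
      by eventually_elim (auto simp: indicator_def)
    have eq: "(\<integral>x\<in>A. g x \<partial>M) = (\<integral>x\<in>B. g x \<partial>M)" if "integrable M g" for g :: "'a \<Rightarrow> real"
      unfolding set_lebesgue_integral_def using AB AM BM that
      by (intro integral_cong_AE) auto
    show "(\<integral>x\<in>A. f x \<partial>M) = (\<integral>x\<in>A. real_cond_exp M H f x \<partial>M)"
      unfolding eq[OF f] eq[OF H.real_cond_exp_int(1)[OF f]]
      by (rule H.real_cond_exp_intA[OF f B(1)])
  qed
  then show ?thesis by eventually_elim simp
qed

section \<open>Reverse martingales\<close>

text \<open>The second moments of the reverse martingale decrease, so it is Cauchy in $L^2$; the almost sure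
  limit along a fast subsequence is tail measurable.\<close>

lemma (in prob_space) reverse_martingale_tends_to_const_L1:
  fixes Z :: "nat \<Rightarrow> 'a \<Rightarrow> real"
  assumes F: "\<And>d. subalgebra M (F d)" and dec: "\<And>d. sets (F (Suc d)) \<subseteq> sets (F d)"
    and Z: "martingale_rev M F Z" and bdd: "\<And>d x. x \<in> space M \<Longrightarrow> \<bar>Z d x\<bar> \<le> 1"
    and triv: "\<And>A. (\<And>d. A \<in> sets (F d)) \<Longrightarrow> prob A = 0 \<or> prob A = 1"
  shows "\<exists>c. \<forall>e>0. \<exists>d. expectation (\<lambda>x. \<bar>Z d x - c\<bar>) < e"
proof -
  have ZF: "Z d \<in> borel_measurable (F d)" for d using Z by (auto simp: martingale_rev_def)
  have subF: "sets (F e) \<subseteq> sets (F d)" if "d \<le> e" for d e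
    using that by (rule lift_Suc_antimono_le[of "\<lambda>d. sets (F d)", OF dec])
  have subalg: "subalgebra (F d) (F e)" if "d \<le> e" for d e
    using subF[OF that] F by (auto simp: subalgebra_def)
  have ZFle: "Z e \<in> borel_measurable (F d)" if "d \<le> e" for d e
    using measurable_from_subalg[OF subalg[OF that] ZF] .
  have ZM [measurable]: "Z d \<in> borel_measurable M" for d
    using measurable_from_subalg[OF F ZF] .
  have bddAE: "AE x in M. \<bar>Z d x\<bar> \<le> 1" for d using bdd by auto
  have int [simp]: "integrable M (Z d)" for d
    by (rule integrable_const_bound[where B=1]) (use bddAE in auto)
  have bdd2: "\<bar>Z d x * Z e x\<bar> \<le> 1" if "x \<in> space M" for d e x
    unfolding abs_mult using bdd[OF that] by (intro mult_le_one) auto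
  have int2 [simp]: "integrable M (\<lambda>x. Z d x * Z e x)" for d e
    by (rule integrable_const_bound[where B=1]) (use bdd2 in auto)
  \<comment> \<open>Induction from \<open>e\<close> down to \<open>d\<close>: as \<open>Z e\<close>
    is measurable for \<open>F (Suc d)\<close>, conditioning replaces \<open>Z d\<close> by
    \<open>Z (Suc d)\<close> under the integral. Increments are thus orthogonal to later
    terms.\<close>
  have orth: "expectation (\<lambda>x. Z e x * Z d x) = expectation (\<lambda>x. Z e x * Z e x)" if "d \<le> e" for d e
    using that
  proof (induction d rule: inc_induct)
    case base then show ?case by simp
  next
    case (step d)
    interpret S: sigma_finite_subalgebra M "F (Suc d)" by (rule sigma_finite_subalgebraI[OF F])
    have "expectation (\<lambda>x. Z e x * Z d x) = expectation (\<lambda>x. Z e x * real_cond_exp M (F (Suc d)) (Z d) x)"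
      using step by (intro S.real_cond_exp_intg(2)[symmetric] ZFle) auto
    also have "\<dots> = expectation (\<lambda>x. Z e x * Z (Suc d) x)"
    proof (rule integral_cong_AE)
      have "AE x in M. real_cond_exp M (F (Suc d)) (Z d) x = Z (Suc d) x"
        using Z by (auto simp: martingale_rev_def)
      then show "AE x in M. Z e x * real_cond_exp M (F (Suc d)) (Z d) x = Z e x * Z (Suc d) x"
        by eventually_elim simp
    qed (auto intro!: borel_measurable_times)
    finally show ?case using step.IH by simp
  qed
  define m where "m d = expectation (\<lambda>x. Z d x * Z d x)" for d
  have L2: "expectation (\<lambda>x. (Z d x - Z e x)^2) = m d - m e" if "d \<le> e" for d e
  proof -
    have "expectation (\<lambda>x. (Z d x - Z e x)^2)
        = expectation (\<lambda>x. Z d x * Z d x - 2 * (Z e x * Z d x) + Z e x * Z e x)"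
      by (intro Bochner_Integration.integral_cong) (auto simp: power2_eq_square algebra_simps)
    also have "\<dots> = m d - 2 * expectation (\<lambda>x. Z e x * Z d x) + m e"
      by (simp add: m_def del: integral_mult_right_zero)
    finally show ?thesis using orth[OF that] by (simp add: m_def)
  qed
  have m_dec: "m e \<le> m d" if "d \<le> e" for d e
    proof -
    have "0 \<le> expectation (\<lambda>x. (Z d x - Z e x)^2)" by simp
    then show ?thesis using L2[OF that] by simp
  qed
  have "decseq m" using m_dec by (auto simp: decseq_def)
  moreover have m_nonneg: "0 \<le> m d" for d unfolding m_def by simp
  ultimately have "Cauchy m"
    by (intro convergent_Cauchy Bseq_monoseq_convergent decseq_imp_monoseq decseq_bounded[of m 0]) auto
  \<comment> \<open>The rate $(1/4)^i$ for second moments gives $L^1$ increments of at most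
    $(1/2)^i$, because a variance is nonnegative; these are summable, which yields almost sure
    convergence along \<open>s\<close>.\<close>
  have "\<exists>s. strict_mono s \<and> (\<forall>i. \<forall>e\<ge>s i. m (s i) - m e \<le> (1/4)^i)"
  proof -
    have "\<exists>N. \<forall>d\<ge>N. \<forall>e\<ge>d. m d - m e \<le> (1/4)^i" for i :: nat
      using CauchyD[OF \<open>Cauchy m\<close>, of "(1/4)^i"]
      by auto (metis abs_le_D1 le_trans less_imp_le)
    then obtain N where N: "\<And>i d e. N i \<le> d \<Longrightarrow> d \<le> e \<Longrightarrow> m d - m e \<le> (1/4)^i" by metis
    define s where "s = rec_nat (N 0) (\<lambda>i r. max (Suc r) (N (Suc i)))"
    have s: "s 0 = N 0" "s (Suc i) = max (Suc (s i)) (N (Suc i))" for i by (auto simp: s_def)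
    have "N i \<le> s i" for i by (cases i) (auto simp: s)
    moreover have "strict_mono s" by (rule strict_monoI_Suc) (auto simp: s)
    ultimately show ?thesis using N by blast
  qed
  then obtain s where s: "strict_mono s" "\<And>i e. s i \<le> e \<Longrightarrow> m (s i) - m e \<le> (1/4)^i" by auto
  define D where "D i x = \<bar>Z (s (Suc i)) x - Z (s i) x\<bar>" for i x
  have D_bdd: "\<bar>D i x\<bar> \<le> 2" if "x \<in> space M" for i x
    unfolding D_def using bdd[OF that, of "s (Suc i)"] bdd[OF that, of "s i"] by auto
  have DM [measurable]: "D i \<in> borel_measurable M" for i unfolding D_def by measurable
  have D_int: "integrable M (D i)" for i
    by (rule integrable_const_bound[where B=2]) (use D_bdd in auto)
  have D_le: "expectation (D i) \<le> (1/2)^i" for i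
  proof -
    have "D i x ^ 2 = (Z (s i) x - Z (s (Suc i)) x)^2" for x
      by (simp add: D_def power2_commute)
    then have "expectation (\<lambda>x. D i x ^ 2) = m (s i) - m (s (Suc i))"
      using L2[of "s i" "s (Suc i)"] s(1) by (simp add: strict_mono_less_eq)
    also have "\<dots> \<le> (1/4)^i" using s by (simp add: strict_mono_less_eq)
    finally have 1: "expectation (\<lambda>x. D i x ^ 2) \<le> ((1/2)^i)^2"
      by (simp add: power_mult[symmetric] mult.commute[of i 2]) (simp add: power_mult power2_eq_square)
    have "D i x ^ 2 \<le> 4" if "x \<in> space M" for x
      using power_mono[OF D_bdd[OF that, of i], of 2] by simp
    then have "integrable M (\<lambda>x. D i x ^ 2)"
      by (intro integrable_const_bound[where B=4]) auto
    then have "variance (D i) = expectation (\<lambda>x. D i x ^ 2) - (expectation (D i))^2"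
      by (intro variance_eq D_int)
    moreover have "variance (D i) \<ge> 0" by simp
    ultimately have "(expectation (D i))^2 \<le> ((1/2)^i)^2" using 1 by linarith
    then show ?thesis by (rule power2_le_imp_le) simp
  qed
  have "AE x in M. summable (\<lambda>i. D i x)"
  proof -
    have "(\<integral>\<^sup>+x. (\<Sum>i. ennreal (D i x)) \<partial>M) = (\<Sum>i. \<integral>\<^sup>+x. ennreal (D i x) \<partial>M)"
      by (rule nn_integral_suminf) simp
    also have "\<dots> = (\<Sum>i. ennreal (expectation (D i)))"
      by (intro suminf_cong nn_integral_eq_integral D_int) (auto simp: D_def)
    also have "\<dots> \<le> (\<Sum>i. ennreal ((1/2)^i))"
      by (intro suminf_le ennreal_leI D_le) auto
    also have "\<dots> = ennreal (\<Sum>i. (1/2)^i)" by (intro suminf_ennreal2) auto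
    also have "\<dots> < \<infinity>" by simp
    finally have "AE x in M. (\<Sum>i. ennreal (D i x)) \<noteq> \<infinity>"
      by (intro nn_integral_noteq_infinite) auto
    then show ?thesis
      by eventually_elim (intro summable_suminf_not_top, auto simp: D_def)
  qed
  then have conv: "AE x in M. convergent (\<lambda>i. Z (s i) x)"
  proof eventually_elim
    case (elim x)
    then have "summable (\<lambda>i. Z (s (Suc i)) x - Z (s i) x)"
      using summable_rabs_cancel by (simp add: D_def)
    then have "convergent (\<lambda>n. \<Sum>i<n. Z (s (Suc i)) x - Z (s i) x)" by (simp add: summable_iff_convergent)
    then have "convergent (\<lambda>n. Z (s n) x - Z (s 0) x)"
      by (simp only: sum_lessThan_telescope[of "\<lambda>m. Z (s m) x"])
    then have "convergent (\<lambda>n. (Z (s n) x - Z (s 0) x) + Z (s 0) x)"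
      by (intro convergent_add convergent_const)
    then show ?case by simp
  qed
  define W where "W x = lim (\<lambda>i. Z (s i) x)" for x
  \<comment> \<open>The limit ignores the first \<open>d\<close> terms, and the remaining indices
    \<open>s (i + d)\<close> are at least \<open>d\<close>; hence \<open>W\<close> is measurable for
    every \<open>F d\<close>.\<close>
  have WF: "W \<in> borel_measurable (F d)" for d
  proof -
    have "W = (\<lambda>x. lim (\<lambda>i. Z (s (i + d)) x))"
      unfolding W_def lim_def
      by (intro ext arg_cong[where f=The]) (auto intro: LIMSEQ_ignore_initial_segment[where f="\<lambda>i. Z (s i) _"]
          LIMSEQ_offset[where f="\<lambda>i. Z (s i) _"])
    moreover have "d \<le> s (i + d)" for i using seq_suble[OF s(1), of "i + d"] by simp
    ultimately show ?thesis by (auto intro!: borel_measurable_lim_metric ZFle)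
  qed
  have WM [measurable]: "W \<in> borel_measurable M" using measurable_from_subalg[OF F WF] .
  have lim: "AE x in M. (\<lambda>i. Z (s i) x) \<longlonglongrightarrow> W x"
    using conv by eventually_elim (simp add: W_def convergent_LIMSEQ_iff)
  have Wb: "AE x in M. \<bar>W x\<bar> \<le> 1"
    using lim AE_space
  proof eventually_elim
    case (elim x)
    from elim(1) have "(\<lambda>i. \<bar>Z (s i) x\<bar>) \<longlonglongrightarrow> \<bar>W x\<bar>" by (rule tendsto_rabs)
    then show ?case by (rule LIMSEQ_le_const2) (use bdd elim in auto)
  qed
  have Wint: "integrable M W" by (rule integrable_const_bound[where B=1]) (use Wb in auto)
  define c where "c = expectation W"
  \<comment> \<open>A function with mean zero is not almost surely positive. By triviality the
    events \<open>W > c\<close> and \<open>W < c\<close> have probability 0 or 1, and this rules out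
    1 for both.\<close>
  have neg: "\<not> (AE x in M. 0 < f x)" if f: "integrable M f" "expectation f = 0" for f :: "'a \<Rightarrow> real"
  proof
    assume pos: "AE x in M. 0 < f x"
    then have "AE x in M. 0 \<le> f x" by eventually_elim simp
    then have "AE x in M. f x = 0" using f by (simp add: integral_nonneg_eq_0_iff_AE)
    with pos have "AE x in M. False" by eventually_elim simp
    then show False by simp
  qed
  have gt: "prob {x\<in>space M. W x > c} = 0"
  proof (rule ccontr)
    assume "prob {x\<in>space M. W x > c} \<noteq> 0"
    moreover have "{x\<in>space M. W x > c} \<in> sets (F d)" for d
    proof -
      have "{x\<in>space (F d). W x > c} \<in> sets (F d)" using WF by measurable
      then show ?thesis using F by (simp add: subalgebra_def)
    qed
    ultimately have "prob {x\<in>space M. W x > c} = 1" using triv by blast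
    then have "AE x in M. W x > c" by (subst (asm) prob_Collect_eq_1) auto
    then have "AE x in M. 0 < W x - c" by eventually_elim simp
    then show False using neg[of "\<lambda>x. W x - c"] Wint by (simp add: c_def prob_space)
  qed
  have lt: "prob {x\<in>space M. W x < c} = 0"
  proof (rule ccontr)
    assume "prob {x\<in>space M. W x < c} \<noteq> 0"
    moreover have "{x\<in>space M. W x < c} \<in> sets (F d)" for d
    proof -
      have "{x\<in>space (F d). W x < c} \<in> sets (F d)" using WF by measurable
      then show ?thesis using F by (simp add: subalgebra_def)
    qed
    ultimately have "prob {x\<in>space M. W x < c} = 1" using triv by blast
    then have "AE x in M. W x < c" by (subst (asm) prob_Collect_eq_1) auto
    then have "AE x in M. 0 < c - W x" by eventually_elim simp
    then show False using neg[of "\<lambda>x. c - W x"] Wint by (simp add: c_def prob_space)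
  qed
  have "AE x in M. \<not> W x > c" using gt by (subst (asm) prob_Collect_eq_0) auto
  moreover have "AE x in M. \<not> W x < c" using lt by (subst (asm) prob_Collect_eq_0) auto
  ultimately have Wc: "AE x in M. W x = c" by eventually_elim simp
  have "(\<lambda>i. expectation (\<lambda>x. \<bar>Z (s i) x - c\<bar>)) \<longlonglongrightarrow> expectation (\<lambda>x. 0)"
  proof (rule integral_dominated_convergence[where w="\<lambda>_. 1 + \<bar>c\<bar>"])
    show "AE x in M. (\<lambda>i. \<bar>Z (s i) x - c\<bar>) \<longlonglongrightarrow> 0"
      using lim Wc
    proof eventually_elim
      case (elim x)
      then have "(\<lambda>i. Z (s i) x - c) \<longlonglongrightarrow> 0" by (simp add: LIM_zero)
      then show ?case by (rule tendsto_rabs_zero)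
    qed
    show "AE x in M. norm \<bar>Z (s i) x - c\<bar> \<le> 1 + \<bar>c\<bar>" for i
    proof -
      have "norm \<bar>Z (s i) x - c\<bar> \<le> 1 + \<bar>c\<bar>" if "x \<in> space M" for x
        using bdd[OF that, of "s i"] by (simp add: abs_if split: if_splits)
      then show ?thesis by auto
    qed
  qed auto
  then have lim0: "(\<lambda>i. expectation (\<lambda>x. \<bar>Z (s i) x - c\<bar>)) \<longlonglongrightarrow> 0" by simp
  have "\<exists>d. expectation (\<lambda>x. \<bar>Z d x - c\<bar>) < e" if "e > 0" for e
  proof -
    have "eventually (\<lambda>i. expectation (\<lambda>x. \<bar>Z (s i) x - c\<bar>) < e) sequentially"
      using lim0 that by (rule order_tendstoD)
    then show ?thesis by (auto simp: eventually_sequentially)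
  qed
  then show ?thesis by blast
qed

section \<open>The filtrations\<close>

lemma space_Gfilt [simp]: "space (Gfilt M V E k) = space M"
  by (simp add: Gfilt_def space_measure_of_conv)

lemma space_Ufilt [simp]: "space (Ufilt M U k) = space M"
  by (simp add: Ufilt_def space_measure_of_conv)

lemma space_Vgen [simp]: "space (Vgen M V k) = space M"
  by (simp add: Vgen_def space_measure_of_conv)

lemma nat_events_subset_iff:
  assumes "space N = space M"
  shows "nat_events M X \<subseteq> sets N \<longleftrightarrow> X \<in> measurable N (count_space UNIV)"
  using assms by (auto simp: nat_events_def measurable_def)

lemma real_events_subset_iff:
  assumes "space N = space M"
  shows "real_events M X \<subseteq> sets N \<longleftrightarrow> X \<in> borel_measurable N"
  using assms by (auto simp: real_events_def measurable_def)

lemma Gfilt_generators_Pow: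
  "(\<Union>j\<in>{k..}. nat_events M (V j) \<union> nat_events M (E j)) \<subseteq> Pow (space M)"
  by (auto simp: nat_events_def)

lemma Ufilt_generators_Pow: "(\<Union>j\<in>{k..}. real_events M (U j)) \<subseteq> Pow (space M)"
  by (auto simp: real_events_def)

lemma measurable_Gfilt:
  assumes "k \<le> j"
  shows "V j \<in> measurable (Gfilt M V E k) (count_space UNIV)"
    and "E j \<in> measurable (Gfilt M V E k) (count_space UNIV)"
proof -
  have "nat_events M (V j) \<union> nat_events M (E j) \<subseteq> sets (Gfilt M V E k)"
    unfolding Gfilt_def using Gfilt_generators_Pow[of M V E k] assms by auto
  then show "V j \<in> measurable (Gfilt M V E k) (count_space UNIV)"
    "E j \<in> measurable (Gfilt M V E k) (count_space UNIV)"
    by (auto simp: nat_events_subset_iff[symmetric, where M=M])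
qed

lemma measurable_Ufilt: "k \<le> j \<Longrightarrow> U j \<in> borel_measurable (Ufilt M U k)"
  unfolding real_events_subset_iff[symmetric, where M=M, OF space_Ufilt]
  unfolding Ufilt_def using Ufilt_generators_Pow[of M U k] by auto

lemma measurable_into_Gfilt:
  assumes "g \<in> space N \<rightarrow> space M"
    and V: "\<And>j. k \<le> j \<Longrightarrow> (\<lambda>x. V j (g x)) \<in> measurable N (count_space UNIV)"
    and E: "\<And>j. k \<le> j \<Longrightarrow> (\<lambda>x. E j (g x)) \<in> measurable N (count_space UNIV)"
  shows "g \<in> measurable N (Gfilt M V E k)"
  unfolding Gfilt_def
proof (rule measurable_measure_of[OF Gfilt_generators_Pow assms(1)])
  fix y assume "y \<in> (\<Union>j\<in>{k..}. nat_events M (V j) \<union> nat_events M (E j))"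
  then obtain j A where j: "k \<le> j" and y: "y = V j -` A \<inter> space M \<or> y = E j -` A \<inter> space M"
    by (auto simp: nat_events_def)
  have "g -` (V j -` A \<inter> space M) \<inter> space N = (\<lambda>x. V j (g x)) -` A \<inter> space N"
    "g -` (E j -` A \<inter> space M) \<inter> space N = (\<lambda>x. E j (g x)) -` A \<inter> space N"
    using assms(1) by auto
  with y measurable_sets[OF V[OF j], of A] measurable_sets[OF E[OF j], of A]
  show "g -` y \<inter> space N \<in> sets N" by auto
qed

lemma measurable_into_Ufilt:
  assumes "g \<in> space N \<rightarrow> space M"
    and U: "\<And>j. k \<le> j \<Longrightarrow> (\<lambda>x. U j (g x)) \<in> borel_measurable N"
  shows "g \<in> measurable N (Ufilt M U k)"
  unfolding Ufilt_def
proof (rule measurable_measure_of[OF Ufilt_generators_Pow assms(1)])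
  fix y assume "y \<in> (\<Union>j\<in>{k..}. real_events M (U j))"
  then obtain j A where j: "k \<le> j" and A: "A \<in> sets borel" and y: "y = U j -` A \<inter> space M"
    by (auto simp: real_events_def)
  have "g -` (U j -` A \<inter> space M) \<inter> space N = (\<lambda>x. U j (g x)) -` A \<inter> space N"
    using assms(1) by auto
  with y measurable_sets[OF U[OF j] A]
  show "g -` y \<inter> space N \<in> sets N" by auto
qed

text \<open>The identity serves as test map: an inclusion of sigma-algebras becomes measurability of
  the coordinates for the larger one.\<close>

lemma sets_Gfilt_subset:
  assumes "space N = space M"
    and "\<And>j. k \<le> j \<Longrightarrow> V j \<in> measurable N (count_space UNIV)"
    and "\<And>j. k \<le> j \<Longrightarrow> E j \<in> measurable N (count_space UNIV)"
  shows "sets (Gfilt M V E k) \<subseteq> sets N"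
proof
  fix A assume A: "A \<in> sets (Gfilt M V E k)"
  have "(\<lambda>x. x) \<in> measurable N (Gfilt M V E k)"
    using assms by (intro measurable_into_Gfilt) auto
  from measurable_sets[OF this A] show "A \<in> sets N"
    using sets.sets_into_space[OF A] assms(1) by (simp add: Int_absorb2)
qed

lemma sets_Ufilt_subset:
  assumes "space N = space M" and "\<And>j. k \<le> j \<Longrightarrow> U j \<in> borel_measurable N"
  shows "sets (Ufilt M U k) \<subseteq> sets N"
proof
  fix A assume A: "A \<in> sets (Ufilt M U k)"
  have "(\<lambda>x. x) \<in> measurable N (Ufilt M U k)"
    using assms by (intro measurable_into_Ufilt) auto
  from measurable_sets[OF this A] show "A \<in> sets N"
    using sets.sets_into_space[OF A] assms(1) by (simp add: Int_absorb2)
qed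

lemma sets_Gfilt_antimono: "k \<le> j \<Longrightarrow> sets (Gfilt M V E j) \<subseteq> sets (Gfilt M V E k)"
  by (rule sets_Gfilt_subset) (auto intro: measurable_Gfilt)

lemma sets_Ufilt_antimono: "k \<le> j \<Longrightarrow> sets (Ufilt M U j) \<subseteq> sets (Ufilt M U k)"
  by (rule sets_Ufilt_subset) (auto intro: measurable_Ufilt)

lemma subalgebra_Gfilt:
  assumes "\<And>j. V j \<in> measurable M (count_space UNIV)" "\<And>j. E j \<in> measurable M (count_space UNIV)"
  shows "subalgebra M (Gfilt M V E k)"
  using sets_Gfilt_subset[of M M k V E] assms by (simp add: subalgebra_def)

lemma subalgebra_Ufilt:
  assumes "\<And>j. U j \<in> borel_measurable M"
  shows "subalgebra M (Ufilt M U k)"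
  using sets_Ufilt_subset[of M M k U] assms by (simp add: subalgebra_def)

lemma sets_Vgen: "sets (Vgen M V k) = nat_events M (V k)"
proof -
  have "sets (vimage_algebra (space M) (V k) (count_space UNIV)) = sets (Vgen M V k)"
    unfolding Vgen_def vimage_algebra_def nat_events_def by (intro arg_cong[where f=sets] arg_cong2[where f=sigma]) auto
  then show ?thesis by (subst (asm) sets_vimage_algebra2) (auto simp: nat_events_def)
qed

text \<open>A finite index set is peeled at its least element \<open>b\<close>, since the other
  events lie in \<open>Ufilt M U (Suc b)\<close>. Indices run against time, so the least index is
  the latest parameter.\<close>

lemma (in prob_space) indep_vars_if_indep_future:
  assumes U: "\<And>k. U k \<in> borel_measurable M"
    and indep: "\<And>k. indep_set (sets (Ufilt M U (Suc k))) (real_events M (U k))"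
  shows "indep_vars (\<lambda>_. borel) U UNIV"
  unfolding indep_vars_def2
proof (intro conjI ballI U indep_setsI)
  show "{U i -` A \<inter> space M |A. A \<in> sets borel} \<subseteq> events" for i
    using U by auto
next
  fix A J assume J: "J \<noteq> {}" "J \<subseteq> UNIV" "finite J"
    and A: "\<forall>j\<in>J. A j \<in> {U j -` A \<inter> space M |A. A \<in> sets borel}"
  from J(3,1) A show "prob (\<Inter>j\<in>J. A j) = (\<Prod>j\<in>J. prob (A j))"
  proof (induction rule: finite_linorder_min_induct)
    case empty then show ?case by simp
  next
    case (insert b J)
    have b: "A b \<in> real_events M (U b)" using insert.prems by (auto simp: real_events_def)
    show ?case
    proof (cases "J = {}")
      case False
      have "A j \<in> sets (Ufilt M U (Suc b))" if "j \<in> J" for j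
      proof -
        from that insert.hyps have "Suc b \<le> j" by auto
        from measurable_Ufilt[OF this] have "real_events M (U j) \<subseteq> sets (Ufilt M U (Suc b))"
          by (subst real_events_subset_iff) auto
        then show ?thesis using insert.prems that by (auto simp: real_events_def)
      qed
      then have "(\<Inter>j\<in>J. A j) \<in> sets (Ufilt M U (Suc b))"
        using False insert.hyps by (intro sets.finite_INT) auto
      from indep_setD[OF indep this b]
      have "prob ((\<Inter>j\<in>J. A j) \<inter> A b) = prob (\<Inter>j\<in>J. A j) * prob (A b)" .
      moreover have "b \<notin> J" using insert.hyps by auto
      ultimately show ?thesis
        using insert.IH[OF False] insert.prems insert.hyps by (simp add: Int_commute mult.commute)
    qed simp
  qed
qed

lemma Int_stable_preimages: "Int_stable {X -` A \<inter> \<Omega> |A. A \<in> sets S}"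
proof (rule Int_stableI)
  fix a b assume "a \<in> {X -` A \<inter> \<Omega> |A. A \<in> sets S}" "b \<in> {X -` A \<inter> \<Omega> |A. A \<in> sets S}"
  then obtain A B where "A \<in> sets S" "B \<in> sets S" "a = X -` A \<inter> \<Omega>" "b = X -` B \<inter> \<Omega>" by auto
  then have "A \<inter> B \<in> sets S" "a \<inter> b = X -` (A \<inter> B) \<inter> \<Omega>" by auto
  then show "a \<inter> b \<in> {X -` A \<inter> \<Omega> |A. A \<in> sets S}" by blast
qed

text \<open>Fubini for an independent pair. As \<open>X\<close> takes finitely many values, the
  integral splits over the events \<open>X = a\<close>, and on each of them independence factors it;
  measurability of every section \<open>\<psi> a\<close> is enough for this.\<close>

lemma (in prob_space) integral_indep_discrete:
  fixes \<psi> :: "'b::countable \<Rightarrow> real \<Rightarrow> real"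
  assumes H: "subalgebra M H" and X: "X \<in> measurable H (count_space UNIV)"
    and S: "finite S" "AE x in M. X x \<in> S"
    and U: "U \<in> borel_measurable M" and indep: "indep_set (sets H) (real_events M U)"
    and \<psi>: "\<And>a. \<psi> a \<in> borel_measurable borel" "\<And>a t. \<bar>\<psi> a t\<bar> \<le> B"
  shows "expectation (\<lambda>x. \<psi> (X x) (U x)) = expectation (\<lambda>x. \<integral>t. \<psi> (X x) t \<partial>distr M borel U)"
proof -
  have XM: "X \<in> measurable M (count_space UNIV)" using measurable_from_subalg[OF H X] .
  have [measurable]: "(\<lambda>x. \<psi> a (U x)) \<in> borel_measurable M" for a
    using measurable_compose[OF U \<psi>(1)] .
  have evH: "X -` {a} \<inter> space M \<in> sets H" for a
    using measurable_sets[OF X, of "{a}"] H by (simp add: subalgebra_def)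
  have ev [measurable]: "X -` {a} \<inter> space M \<in> events" for a
    using evH H by (auto simp: subalgebra_def)
  define I where "I a = (indicator (X -` {a} \<inter> space M) :: 'a \<Rightarrow> real)" for a
  have IH: "I a \<in> borel_measurable H" for a unfolding I_def using evH by simp
  have [measurable]: "I a \<in> borel_measurable M" for a unfolding I_def by simp
  have I_int: "integrable M (I a)" for a
    unfolding I_def by (simp add: less_top[symmetric])
  have \<psi>_int: "integrable M (\<lambda>x. \<psi> a (U x))" for a
    by (rule integrable_const_bound[where B=B]) (use \<psi>(2) in auto)
  have ind: "indep_var borel (I a) borel (\<lambda>x. \<psi> a (U x))" for a
  proof -
    have "{I a -` A \<inter> space M |A. A \<in> sets borel} \<subseteq> sets H"
      using measurable_sets[OF IH] H by (auto simp: subalgebra_def)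
    then have 1: "sigma_sets (space M) {I a -` A \<inter> space M |A. A \<in> sets borel} \<subseteq> sets H"
      using H sets.sigma_sets_subset[of "{I a -` A \<inter> space M |A. A \<in> sets borel}" H] by (simp add: subalgebra_def)
    have "(\<lambda>x. \<psi> a (U x)) -` A \<inter> space M = U -` (\<psi> a -` A) \<inter> space M" for A by auto
    moreover have "\<psi> a -` A \<in> sets borel" if "A \<in> sets borel" for A
      using measurable_sets[OF \<psi>(1) that] by simp
    ultimately have 2: "{(\<lambda>x. \<psi> a (U x)) -` A \<inter> space M |A. A \<in> sets borel} \<subseteq> real_events M U"
      by (auto simp: real_events_def) blast
    have "indep_set {I a -` A \<inter> space M |A. A \<in> sets borel} {(\<lambda>x. \<psi> a (U x)) -` A \<inter> space M |A. A \<in> sets borel}"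
      using indep 1 2 unfolding indep_sets2_eq by blast
    then show ?thesis
      unfolding indep_var_eq by (intro conjI indep_set_sigma_sets Int_stable_preimages) simp_all
  qed
  have sum: "AE x in M. f (X x) x = (\<Sum>a\<in>S. I a x * f a x)" for f :: "'b \<Rightarrow> 'a \<Rightarrow> real"
    using S(2) AE_space
  proof eventually_elim
    case (elim x)
    then have "(\<Sum>a\<in>S. I a x * f a x) = (\<Sum>a\<in>S. if a = X x then f a x else 0)"
      by (intro sum.cong) (auto simp: I_def)
    then show ?case using elim S by simp
  qed
  have "expectation (\<lambda>x. \<psi> (X x) (U x)) = expectation (\<lambda>x. \<Sum>a\<in>S. I a x * \<psi> a (U x))"
  proof (rule integral_cong_AE)
    show "(\<lambda>x. \<psi> (X x) (U x)) \<in> borel_measurable M"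
      by (rule measurable_compose_countable[OF _ XM]) simp
    show "AE x in M. \<psi> (X x) (U x) = (\<Sum>a\<in>S. I a x * \<psi> a (U x))"
      by (rule sum[of "\<lambda>a x. \<psi> a (U x)"])
  qed simp
  also have "\<dots> = (\<Sum>a\<in>S. expectation (\<lambda>x. I a x * \<psi> a (U x)))"
    by (intro Bochner_Integration.integral_sum indep_var_integrable ind I_int \<psi>_int)
  also have "\<dots> = (\<Sum>a\<in>S. expectation (I a) * expectation (\<lambda>x. \<psi> a (U x)))"
    by (intro sum.cong refl indep_var_lebesgue_integral ind I_int \<psi>_int)
  also have "\<dots> = (\<Sum>a\<in>S. expectation (I a) * (\<integral>t. \<psi> a t \<partial>distr M borel U))"
    by (subst integral_distr[OF U \<psi>(1)]) simp
  also have "\<dots> = (\<Sum>a\<in>S. expectation (\<lambda>x. I a x * (\<integral>t. \<psi> a t \<partial>distr M borel U)))"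
    by simp
  also have "\<dots> = expectation (\<lambda>x. \<Sum>a\<in>S. I a x * (\<integral>t. \<psi> a t \<partial>distr M borel U))"
    by (intro Bochner_Integration.integral_sum[symmetric] integrable_mult_left I_int)
  also have "\<dots> = expectation (\<lambda>x. \<integral>t. \<psi> (X x) t \<partial>distr M borel U)"
  proof (rule integral_cong_AE)
    show "(\<lambda>x. \<integral>t. \<psi> (X x) t \<partial>distr M borel U) \<in> borel_measurable M"
      using XM by (rule measurable_compose) simp
    show "AE x in M. (\<Sum>a\<in>S. I a x * (\<integral>t. \<psi> a t \<partial>distr M borel U)) = (\<integral>t. \<psi> (X x) t \<partial>distr M borel U)"
      using sum[of "\<lambda>a _. \<integral>t. \<psi> a t \<partial>distr M borel U"] by eventually_elim simp
  qed auto
  finally show ?thesis .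
qed

section \<open>Backward chains with a monotone kernel\<close>

abbreviation vert :: "nat \<Rightarrow> (nat \<Rightarrow> nat \<times> nat) \<Rightarrow> nat" where "vert k f \<equiv> fst (f k)"
abbreviation lab :: "nat \<Rightarrow> (nat \<Rightarrow> nat \<times> nat) \<Rightarrow> nat" where "lab k f \<equiv> snd (f k)"

text \<open>Parameters have to be real numbers, so a choice of one edge per vertex of level \<open>k+1\<close> is packed into
  a single real; \<open>decode\<close> is junk outside the range of \<open>encode k\<close> and at vertices above \<open>k+1\<close>.\<close>

definition encode :: "nat \<Rightarrow> (nat \<Rightarrow> nat \<times> nat) \<Rightarrow> real" where
  "encode k g = real (to_nat (map g [0..<Suc (Suc k)]))"

definition decode :: "real \<Rightarrow> nat \<Rightarrow> nat \<times> nat" where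
  "decode t u = (from_nat (nat \<lfloor>t\<rfloor>) :: (nat \<times> nat) list) ! u"

definition override :: "nat \<Rightarrow> nat \<Rightarrow> nat \<times> nat \<Rightarrow> real \<Rightarrow> real" where
  "override k u x t = encode k ((decode t)(u := x))"

lemma decode_encode: "u \<le> Suc k \<Longrightarrow> decode (encode k g) u = g u"
  unfolding decode_def encode_def by (simp del: upt_Suc)

lemma encode_cong: "(\<And>u. u \<le> Suc k \<Longrightarrow> g u = h u) \<Longrightarrow> encode k g = encode k h"
  unfolding encode_def by (auto intro!: arg_cong[where f=to_nat] map_cong simp del: upt_Suc)

lemma override_encode: "override k u x (encode k g) = encode k (g(u := x))"
  unfolding override_def by (intro encode_cong) (auto simp: decode_encode)

text \<open>True for every real \<open>t\<close>: whatever junk \<open>t\<close> decodes to is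
  encoded afresh, so no support condition on the noise is involved.\<close>

lemma decode_override: "u \<le> Suc k \<Longrightarrow> decode (override k u x t) u = x"
  unfolding override_def by (simp add: decode_encode)

lemma measurable_nat_floor: "(\<lambda>t::real. nat \<lfloor>t\<rfloor>) \<in> measurable borel (count_space UNIV)"
  by measurable

lemma measurable_decode: "(\<lambda>t. decode t u) \<in> measurable borel (count_space UNIV)"
  unfolding decode_def by (rule measurable_compose[OF measurable_nat_floor]) simp

text \<open>A real enters only through \<open>nat \<lfloor>t\<rfloor>\<close>, so measurability
  factors through a discrete space.\<close>

lemma measurable_override: "override k u x \<in> borel_measurable borel"
  unfolding override_def[abs_def] decode_def[abs_def]
  by (rule measurable_compose[OF measurable_nat_floor]) simp

text \<open>What is kept of the Euler graph and of the measure on its paths. \<open>p_step\<close>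
  is demanded at every \<open>u\<close>, also beyond the level, because transitions are to be
  monotone on all of \<open>nat\<close>, while \<open>p_level\<close> concerns the vertices of level
  \<open>k+1\<close>. The Markov property is stated as a product formula against events of the
  past.\<close>

locale backward_chain = prob_space L for L :: "(nat \<Rightarrow> nat \<times> nat) measure" +
  fixes p :: "nat \<Rightarrow> nat \<Rightarrow> (nat \<times> nat) pmf"
  assumes sets_L: "sets L = sets (PiM UNIV (\<lambda>_. count_space UNIV))"
    and finite_p: "finite (set_pmf (p k u))"
    and p_step: "x \<in> set_pmf (p k u) \<Longrightarrow> fst x \<le> u \<and> u \<le> Suc (fst x)"
    and p_level: "x \<in> set_pmf (p k u) \<Longrightarrow> u \<le> Suc k \<Longrightarrow> fst x \<le> k"
    and AE_level: "AE f in L. vert k f \<le> k"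
    and AE_support: "AE f in L. f k \<in> set_pmf (p k (vert (Suc k) f))"
    and markov: "A \<in> sets (Gfilt L vert lab (Suc k)) \<Longrightarrow>
      prob (A \<inter> {f. f k = x \<and> vert (Suc k) f = u}) = pmf (p k u) x * prob (A \<inter> {f. vert (Suc k) f = u})"
    and tail_trivial: "(\<And>k. A \<in> sets (Gfilt L vert lab k)) \<Longrightarrow> prob A = 0 \<or> prob A = 1"
begin

lemma space_L [simp]: "space L = UNIV"
  using sets_eq_imp_space_eq[OF sets_L] by (simp add: space_PiM PiE_def)

lemma prob_UNIV [simp]: "prob UNIV = 1"
  using prob_space by simp

lemma measurable_coord [measurable]: "(\<lambda>f. f k) \<in> measurable L (count_space UNIV)"
  using measurable_component_singleton[of k UNIV "\<lambda>_. count_space UNIV"]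
  by (simp add: measurable_cong_sets[OF sets_L refl])

lemma measurable_vert [measurable]: "vert k \<in> measurable L (count_space UNIV)"
  using measurable_coord by (rule measurable_compose) simp

lemma measurable_lab [measurable]: "lab k \<in> measurable L (count_space UNIV)"
  using measurable_coord by (rule measurable_compose) simp

abbreviation Gf :: "nat \<Rightarrow> (nat \<Rightarrow> nat \<times> nat) measure" where "Gf \<equiv> Gfilt L vert lab"

lemma subalgebra_Gf: "subalgebra L (Gf k)"
  by (intro subalgebra_Gfilt measurable_vert measurable_lab)

lemma measurable_coord_Gf: "k \<le> j \<Longrightarrow> (\<lambda>f. f j) \<in> measurable (Gf k) (count_space UNIV)"
proof -
  assume "k \<le> j"
  then have "(\<lambda>f. (vert j f, lab j f)) \<in> measurable (Gf k) (count_space UNIV)"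
    by (intro measurable_compose_countable[OF _ measurable_Gfilt(1), where f="\<lambda>a f. (a, lab j f)"]
        measurable_compose[OF measurable_Gfilt(2)]) auto
  then show ?thesis by simp
qed

text \<open>Extends \<open>markov\<close> from single edges to functions of the current vertex and
  the next edge. Almost surely only finitely many vertices and edges occur, so both sides are finite
  sums over the events \<open>B u x\<close> and \<open>C u\<close>.\<close>

lemma markov_integral:
  fixes \<phi> :: "nat \<Rightarrow> nat \<times> nat \<Rightarrow> real"
  assumes A: "A \<in> sets (Gf (Suc k))"
  shows "(\<integral>f. indicator A f * \<phi> (vert (Suc k) f) (f k) \<partial>L)
       = (\<integral>f. indicator A f * measure_pmf.expectation (p k (vert (Suc k) f)) (\<phi> (vert (Suc k) f)) \<partial>L)"
proof -
  have AL [measurable]: "A \<in> events" using A subalgebra_Gf by (auto simp: subalgebra_def)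
  define S where "S u = set_pmf (p k u)" for u
  define B where "B u x = A \<inter> {f. f k = x \<and> vert (Suc k) f = u}" for u x
  define C where "C u = A \<inter> {f. vert (Suc k) f = u}" for u
  have B [measurable]: "B u x \<in> events" for u x
  proof -
    have "{f \<in> space L. f k = x \<and> vert (Suc k) f = u} \<in> events" by measurable
    then show ?thesis unfolding B_def using AL by auto
  qed
  have C [measurable]: "C u \<in> events" for u
  proof -
    have "{f \<in> space L. vert (Suc k) f = u} \<in> events" by measurable
    then show ?thesis unfolding C_def using AL by auto
  qed
  have E: "measure_pmf.expectation (p k u) (\<phi> u) = (\<Sum>x\<in>S u. \<phi> u x * pmf (p k u) x)" for u
    by (rule integral_measure_pmf_real) (auto simp: S_def finite_p)
  have "(\<integral>f. indicator A f * \<phi> (vert (Suc k) f) (f k) \<partial>L)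
      = (\<integral>f. (\<Sum>u\<le>Suc k. \<Sum>x\<in>S u. \<phi> u x * indicator (B u x) f) \<partial>L)"
  proof (rule integral_cong_AE)
    have "(\<lambda>f. \<phi> (vert (Suc k) f) (f k)) \<in> borel_measurable L"
      by (rule measurable_compose_countable[OF _ measurable_vert]) (rule measurable_compose[OF measurable_coord], simp)
    then show "(\<lambda>f. indicator A f * \<phi> (vert (Suc k) f) (f k)) \<in> borel_measurable L" by measurable
    show "AE f in L. indicator A f * \<phi> (vert (Suc k) f) (f k)
        = (\<Sum>u\<le>Suc k. \<Sum>x\<in>S u. \<phi> u x * indicator (B u x) f)"
      using AE_level[of "Suc k"] AE_support[of k]
    proof eventually_elim
      case (elim f)
      have "(\<Sum>u\<le>Suc k. \<Sum>x\<in>S u. \<phi> u x * indicator (B u x) f)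
          = (\<Sum>u\<le>Suc k. if u = vert (Suc k) f then indicator A f * \<phi> u (f k) else 0)"
      proof (intro sum.cong refl)
        fix u
        have "(\<Sum>x\<in>S u. \<phi> u x * indicator (B u x) f)
            = (\<Sum>x\<in>S u. if x = f k then (if u = vert (Suc k) f then indicator A f * \<phi> u x else 0) else 0)"
          by (intro sum.cong refl) (auto simp: B_def indicator_def)
        also have "\<dots> = (if u = vert (Suc k) f then indicator A f * \<phi> u (f k) else 0)"
          using elim by (auto simp: S_def finite_p)
        finally show "(\<Sum>x\<in>S u. \<phi> u x * indicator (B u x) f)
            = (if u = vert (Suc k) f then indicator A f * \<phi> u (f k) else 0)" .
      qed
      then show ?case using elim by simp
    qed
  qed measurable
  also have "\<dots> = (\<Sum>u\<le>Suc k. \<Sum>x\<in>S u. \<phi> u x * prob (B u x))"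
  proof -
    have "integrable L (\<lambda>f. \<phi> u x * indicator (B u x) f)" for u x by (simp add: less_top[symmetric])
    then show ?thesis by (simp add: Bochner_Integration.integral_sum)
  qed
  also have "\<dots> = (\<Sum>u\<le>Suc k. \<Sum>x\<in>S u. \<phi> u x * (pmf (p k u) x * prob (C u)))"
    unfolding B_def C_def using markov[OF A] by simp
  also have "\<dots> = (\<Sum>u\<le>Suc k. measure_pmf.expectation (p k u) (\<phi> u) * prob (C u))"
    unfolding E by (simp add: sum_distrib_right mult.assoc)
  also have "\<dots> = (\<integral>f. (\<Sum>u\<le>Suc k. measure_pmf.expectation (p k u) (\<phi> u) * indicator (C u) f) \<partial>L)"
    by (subst Bochner_Integration.integral_sum) (auto simp: less_top[symmetric])
  also have "\<dots> = (\<integral>f. indicator A f * measure_pmf.expectation (p k (vert (Suc k) f)) (\<phi> (vert (Suc k) f)) \<partial>L)"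
  proof (rule integral_cong_AE)
    have "(\<lambda>f. measure_pmf.expectation (p k (vert (Suc k) f)) (\<phi> (vert (Suc k) f))) \<in> borel_measurable L"
      by (rule measurable_compose[OF measurable_vert]) simp
    then show "(\<lambda>f. indicator A f * measure_pmf.expectation (p k (vert (Suc k) f)) (\<phi> (vert (Suc k) f)))
        \<in> borel_measurable L" by measurable
    show "AE f in L. (\<Sum>u\<le>Suc k. measure_pmf.expectation (p k u) (\<phi> u) * indicator (C u) f)
      = indicator A f * measure_pmf.expectation (p k (vert (Suc k) f)) (\<phi> (vert (Suc k) f))"
      using AE_level[of "Suc k"]
    proof eventually_elim
      case (elim f)
      have "(\<Sum>u\<le>Suc k. measure_pmf.expectation (p k u) (\<phi> u) * indicator (C u) f)
          = (\<Sum>u\<le>Suc k. if u = vert (Suc k) f then indicator A f * measure_pmf.expectation (p k u) (\<phi> u) else 0)"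
        by (intro sum.cong refl) (auto simp: C_def indicator_def)
      then show ?case using elim by simp
    qed
  qed measurable
  finally show ?thesis .
qed

text \<open>\<open>transition k\<close> turns functions on level \<open>k\<close> into functions on level \<open>k+1\<close>, and \<open>transitions k d\<close> into
  functions on level \<open>k+d\<close>.\<close>

definition transition :: "nat \<Rightarrow> (nat \<Rightarrow> real) \<Rightarrow> nat \<Rightarrow> real" where
  "transition k h u = measure_pmf.expectation (p k u) (\<lambda>x. h (fst x))"

fun transitions :: "nat \<Rightarrow> nat \<Rightarrow> (nat \<Rightarrow> real) \<Rightarrow> nat \<Rightarrow> real" where
  "transitions k 0 h = h"
| "transitions k (Suc d) h = transitions (Suc k) d (transition k h)"

text \<open>The defining recursion splits off the step next to level \<open>k\<close>, which suits
  the coupling; the martingale needs the most remote step split off instead.\<close>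

lemma transitions_Suc: "transitions k (Suc d) h = transition (k + d) (transitions k d h)"
  by (induction d arbitrary: k h) simp_all

lemma transition_eq_sum: "transition k h u = (\<Sum>x\<in>set_pmf (p k u). h (fst x) * pmf (p k u) x)"
  unfolding transition_def by (rule integral_measure_pmf_real) (auto simp: finite_p)

lemma transition_ge: "(\<And>x. x \<in> set_pmf (p k u) \<Longrightarrow> c \<le> h (fst x)) \<Longrightarrow> c \<le> transition k h u"
proof -
  assume h: "\<And>x. x \<in> set_pmf (p k u) \<Longrightarrow> c \<le> h (fst x)"
  have "c = (\<Sum>x\<in>set_pmf (p k u). c * pmf (p k u) x)"
    by (simp add: sum_distrib_left[symmetric] sum_pmf_eq_1 finite_p)
  also have "\<dots> \<le> transition k h u"
    unfolding transition_eq_sum by (intro sum_mono mult_right_mono h) auto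
  finally show ?thesis .
qed

lemma transition_le: "(\<And>x. x \<in> set_pmf (p k u) \<Longrightarrow> h (fst x) \<le> c) \<Longrightarrow> transition k h u \<le> c"
  using transition_ge[of k u "-c" "\<lambda>v. - h v"] by (simp add: transition_def)

text \<open>Interlacing: a step from \<open>u\<close> ends at most at \<open>u\<close>, a step from
  \<open>Suc u\<close> at least at \<open>u\<close>, so \<open>h u\<close> separates the two
  means.\<close>

lemma mono_transition:
  assumes "mono h"
  shows "mono (transition k h)"
proof (rule incseq_SucI)
  fix u
  have "transition k h u \<le> h u"
    using p_step by (intro transition_le monoD[OF assms]) blast
  also have "h u \<le> transition k h (Suc u)"
    using p_step by (intro transition_ge monoD[OF assms]) (metis Suc_le_mono)
  finally show "transition k h u \<le> transition k h (Suc u)" .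
qed

lemma transitions_bounds:
  assumes "\<And>v. 0 \<le> h v \<and> h v \<le> 1"
  shows "0 \<le> transitions k d h v \<and> transitions k d h v \<le> 1"
  using assms
proof (induction d arbitrary: k h)
  case (Suc d)
  have "0 \<le> transition k h w \<and> transition k h w \<le> 1" for w
    using Suc.prems by (intro conjI transition_le transition_ge) auto
  from Suc.IH[OF this] show ?case by simp
qed simp

text \<open>The term with index \<open>d\<close> is the conditional expectation of \<open>h\<close>
  at the vertex of level \<open>k\<close>, given the path from level \<open>k + d\<close>
  on.\<close>

lemma martingale_transitions:
  assumes h: "\<And>v. 0 \<le> h v \<and> h v \<le> 1"
  shows "martingale_rev L (\<lambda>d. Gf (k + d)) (\<lambda>d f. transitions k d h (vert (k + d) f))"
  unfolding martingale_rev_def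
proof (intro conjI allI)
  fix d
  show G: "(\<lambda>f. transitions k d h (vert (k + d) f)) \<in> borel_measurable (Gf (k + d))" for d
    by (rule measurable_compose[OF measurable_Gfilt(1)]) auto
  show int: "integrable L (\<lambda>f. transitions k d h (vert (k + d) f))" for d
    by (rule integrable_const_bound[where B=1])
      (use transitions_bounds[OF h, of k d] in \<open>auto intro: measurable_compose[OF measurable_vert]\<close>)
  interpret S: sigma_finite_subalgebra L "Gf (k + Suc d)"
    by (rule sigma_finite_subalgebraI[OF subalgebra_Gf])
  show "AE f in L. real_cond_exp L (Gf (k + Suc d)) (\<lambda>f. transitions k d h (vert (k + d) f)) f
      = transitions k (Suc d) h (vert (k + Suc d) f)"
  proof (rule S.real_cond_exp_charact[OF _ int int G])
    fix A assume A: "A \<in> sets (Gf (k + Suc d))"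
    show "(\<integral>f\<in>A. transitions k d h (vert (k + d) f) \<partial>L) = (\<integral>f\<in>A. transitions k (Suc d) h (vert (k + Suc d) f) \<partial>L)"
      using markov_integral[of A "k + d" "\<lambda>_ x. transitions k d h (fst x)"] A
      unfolding transitions_Suc transition_def set_lebesgue_integral_def by simp
  qed
qed

text \<open>Choose \<open>v\<close> among the values of the chain where the deviation from the limiting constant is at most
  its mean.\<close>

lemma mixing:
  assumes h: "\<And>v. 0 \<le> h v \<and> h v \<le> 1" and e: "0 < e"
  shows "\<exists>d v. v \<le> k + d \<and> expectation (\<lambda>f. \<bar>transitions k d h (vert (k + d) f) - transitions k d h v\<bar>) < e"
proof -
  define Z where "Z d f = transitions k d h (vert (k + d) f)" for d f
  have "\<exists>c. \<forall>e>0. \<exists>d. expectation (\<lambda>f. \<bar>Z d f - c\<bar>) < e"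
  proof (rule reverse_martingale_tends_to_const_L1[of "\<lambda>d. Gf (k + d)"])
    show "martingale_rev L (\<lambda>d. Gf (k + d)) Z"
      unfolding Z_def by (rule martingale_transitions[OF h])
    show "\<bar>Z d f\<bar> \<le> 1" for d f using transitions_bounds[OF h] by (simp add: Z_def)
    show "sets (Gf (k + Suc d)) \<subseteq> sets (Gf (k + d))" for d
      by (rule sets_Gfilt_antimono) simp
    fix A assume A: "\<And>d. A \<in> sets (Gf (k + d))"
    have "A \<in> sets (Gf j)" for j
      using A[of j] sets_Gfilt_antimono[of j "k + j"] by auto
    then show "prob A = 0 \<or> prob A = 1" by (rule tail_trivial)
  qed (rule subalgebra_Gf)
  then obtain c d where cd: "expectation (\<lambda>f. \<bar>Z d f - c\<bar>) < e / 2"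
    using e by (meson half_gt_zero)
  have Zb: "\<bar>Z d f\<bar> \<le> 1" for f using transitions_bounds[OF h] by (simp add: Z_def)
  have ZM [measurable]: "Z d \<in> borel_measurable L"
    unfolding Z_def by (rule measurable_compose[OF measurable_vert]) simp
  have Zi: "integrable L (\<lambda>f. \<bar>Z d f - a\<bar>)" for a
  proof (rule integrable_const_bound[where B="1 + \<bar>a\<bar>"])
    have "norm \<bar>Z d f - a\<bar> \<le> 1 + \<bar>a\<bar>" for f using Zb[of f] by simp
    then show "AE f in L. norm \<bar>Z d f - a\<bar> \<le> 1 + \<bar>a\<bar>" by simp
  qed measurable
  \<comment> \<open>The limit \<open>c\<close> need not be a value of
    \<open>transitions k d h\<close>. A value closer than \<open>e / 2\<close> at an admissible
    vertex replaces it, at the price of a factor two; it exists because the mean deviation is below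
    \<open>e / 2\<close>.\<close>
  have "\<exists>f. vert (k + d) f \<le> k + d \<and> \<bar>Z d f - c\<bar> < e / 2"
  proof (rule ccontr)
    assume far: "\<nexists>f. vert (k + d) f \<le> k + d \<and> \<bar>Z d f - c\<bar> < e / 2"
    have "AE f in L. e / 2 \<le> \<bar>Z d f - c\<bar>"
      using AE_level[of "k + d"] by eventually_elim (use far in \<open>meson not_less\<close>)
    then have "e / 2 \<le> expectation (\<lambda>f. \<bar>Z d f - c\<bar>)"
      by (rule integral_ge_const[OF Zi])
    with cd show False by simp
  qed
  then obtain f0 where f0: "vert (k + d) f0 \<le> k + d" "\<bar>Z d f0 - c\<bar> < e / 2" by auto
  have "expectation (\<lambda>f. \<bar>Z d f - Z d f0\<bar>) \<le> expectation (\<lambda>f. \<bar>Z d f - c\<bar> + \<bar>Z d f0 - c\<bar>)"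
    using Zi by (intro integral_mono) auto
  also have "\<dots> = expectation (\<lambda>f. \<bar>Z d f - c\<bar>) + \<bar>Z d f0 - c\<bar>"
    using Zi by simp
  also have "\<dots> < e" using cd f0 by simp
  finally show ?thesis using f0(1) unfolding Z_def by blast
qed

end

section \<open>The parameterization\<close>

context backward_chain begin

definition noise :: "nat \<Rightarrow> (nat \<Rightarrow> nat \<times> nat) pmf" where
  "noise k = Pi_pmf {..Suc k} (0, 0) (p k)"

definition Q :: "nat \<Rightarrow> real measure" where
  "Q k = distr (measure_pmf (noise k)) borel (encode k)"

definition R :: "(nat \<Rightarrow> real) measure" where "R = PiM UNIV Q"

definition N :: "cspace measure" where "N = L \<Otimes>\<^sub>M R"

text \<open>By the resampling identity \<open>Q_resample\<close> the law of this parameter is \<open>Q k\<close> whatever the current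
  vertex is.\<close>

definition U :: "nat \<Rightarrow> cspace \<Rightarrow> real" where
  "U k z = override k (vert (Suc k) (fst z)) (fst z k) (snd z k)"

text \<open>The entries are independent, so redrawing one of them from its own marginal leaves the
  joint law unchanged.\<close>

lemma noise_resample:
  assumes "u \<le> Suc k"
  shows "noise k = bind_pmf (p k u) (\<lambda>x. map_pmf (\<lambda>g. g(u := x)) (noise k))"
proof -
  have "{..Suc k} = insert u ({..Suc k} - {u})" using assms by auto
  then have "noise k = Pi_pmf (insert u ({..Suc k} - {u})) (0, 0) (p k)"
    unfolding noise_def by simp
  also have "\<dots> = bind_pmf (p k u) (\<lambda>x. bind_pmf (map_pmf (\<lambda>g. g(u := (0, 0))) (noise k))
      (\<lambda>g. return_pmf (g(u := x))))"
    by (subst Pi_pmf_insert') (auto simp: noise_def Pi_pmf_remove)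
  finally show ?thesis by (simp add: map_pmf_def bind_assoc_pmf bind_return_pmf)
qed

lemma noise_component: "u \<le> Suc k \<Longrightarrow> map_pmf (\<lambda>g. g u) (noise k) = p k u"
  unfolding noise_def by (subst Pi_pmf_component) auto

lemma sets_Q [simp, measurable_cong]: "sets (Q k) = sets borel"
  by (simp add: Q_def)

lemma space_Q [simp]: "space (Q k) = UNIV"
  by (simp add: Q_def)

lemma prob_space_Q: "prob_space (Q k)"
  unfolding Q_def by (rule measure_pmf.prob_space_distr) simp

lemma measure_Q: "B \<in> sets borel \<Longrightarrow> measure (Q k) B = measure (noise k) {g. encode k g \<in> B}"
  unfolding Q_def by (subst measure_distr) (auto simp: vimage_def)

lemma override_vimage_borel: "C \<in> sets borel \<Longrightarrow> override k u x -` C \<in> sets borel"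
  using measurable_sets[OF measurable_override, of C k u x] by simp

text \<open>\<open>noise_resample\<close> read through \<open>encode\<close>. The left side is what
  averaging over the next edge produces in \<open>markov_integral\<close>; the right side is free of
  \<open>u\<close>, and here the dependence on the current vertex disappears.\<close>

lemma Q_resample:
  assumes u: "u \<le> Suc k" and C: "C \<in> sets borel"
  shows "measure_pmf.expectation (p k u) (\<lambda>x. measure (Q k) (override k u x -` C)) = measure (Q k) C"
proof -
  have int: "integrable (p k u) (\<lambda>x. measure (Q k) (override k u x -` C))"
    by (rule measure_pmf.integrable_const_bound[where B=1])
      (auto intro: prob_space.prob_le_1[OF prob_space_Q])
  have "ennreal (measure (Q k) C) = emeasure (noise k) {g. encode k g \<in> C}"
    using C by (simp add: measure_Q measure_pmf.emeasure_eq_measure)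
  also have "\<dots> = (\<integral>\<^sup>+x. emeasure (map_pmf (\<lambda>g. g(u := x)) (noise k)) {g. encode k g \<in> C} \<partial>p k u)"
    by (subst noise_resample[OF u]) (rule emeasure_bind_pmf)
  also have "\<dots> = (\<integral>\<^sup>+x. ennreal (measure (Q k) (override k u x -` C)) \<partial>p k u)"
    by (intro nn_integral_cong)
      (simp add: measure_Q[OF override_vimage_borel[OF C]] override_encode measure_pmf.emeasure_eq_measure vimage_Collect_eq)
  also have "\<dots> = ennreal (measure_pmf.expectation (p k u) (\<lambda>x. measure (Q k) (override k u x -` C)))"
    by (rule nn_integral_eq_integral[OF int]) simp
  finally show ?thesis
    by (subst (asm) ennreal_inj) (auto intro: Bochner_Integration.integral_nonneg)
qed

section \<open>The noise sequence, the extended space and independence of the parameters\<close>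

lemma prob_space_R: "prob_space R"
  unfolding R_def by (intro prob_space_PiM prob_space_Q)

lemma space_R [simp]: "space R = UNIV"
  by (simp add: R_def space_PiM PiE_def)

lemma measurable_noise_coord [measurable]: "(\<lambda>w. w k) \<in> borel_measurable R"
  unfolding R_def using measurable_component_singleton[of k UNIV Q]
  by (simp add: measurable_cong_sets[OF refl sets_Q])

abbreviation Rf :: "nat \<Rightarrow> (nat \<Rightarrow> real) measure" where "Rf \<equiv> Ufilt R (\<lambda>k w. w k)"

lemma subalgebra_Rf: "subalgebra R (Rf k)"
  by (rule subalgebra_Ufilt) measurable

lemma indep_noise: "prob_space.indep_vars R (\<lambda>_. borel) (\<lambda>k w. w k) UNIV"
proof -
  interpret R: prob_space R by (rule prob_space_R)
  have "sets (PiM UNIV (\<lambda>_. borel)) = sets (R :: (nat \<Rightarrow> real) measure)"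
    unfolding R_def by (intro sets_PiM_cong) auto
  then have "distr R (PiM UNIV (\<lambda>_. borel)) (\<lambda>x. x) = R"
    by (metis distr_id2)
  moreover have "distr R borel (\<lambda>w. w i) = Q i" for i
  proof -
    have "distr R borel (\<lambda>w. w i) = distr R (Q i) (\<lambda>w. w i)" by (rule distr_cong) auto
    also have "\<dots> = Q i" unfolding R_def by (rule distr_PiM_component) (auto simp: prob_space_Q)
    finally show ?thesis .
  qed
  ultimately show ?thesis
    by (subst R.indep_vars_iff_distr_eq_PiM') (auto simp: R_def[symmetric] restrict_UNIV)
qed

lemma measure_R_coord: "D \<in> sets borel \<Longrightarrow> measure R {w. w k \<in> D} = measure (Q k) D"
proof -
  assume D: "D \<in> sets borel"
  have "measure (Q k) D = measure (distr R (Q k) (\<lambda>w. w k)) D"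
    unfolding R_def by (subst distr_PiM_component) (auto simp: prob_space_Q)
  also have "\<dots> = measure R {w. w k \<in> D}"
    using D by (subst measure_distr) (auto simp: vimage_def measurable_cong_sets[OF refl sets_Q])
  finally show ?thesis by simp
qed

lemma noise_indep_future:
  assumes B: "B \<in> sets (Rf (Suc k))" and D: "D \<in> sets borel"
  shows "measure R (B \<inter> {w. w k \<in> D}) = measure R B * measure (Q k) D"
proof -
  interpret R: prob_space R by (rule prob_space_R)
  \<comment> \<open>Two blocks of coordinates indexed by booleans: \<open>True\<close> for the
    levels beyond \<open>k\<close>, \<open>False\<close> for level \<open>k\<close>. Sigma-algebras
    generated by disjoint blocks of an independent family are independent.\<close>
  define I where "I b = (if b then {Suc k..} else {k})" for b
  have "R.indep_sets (\<lambda>i. real_events R (\<lambda>w. w i)) UNIV"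
    using indep_noise unfolding R.indep_vars_def2 real_events_def by simp
  then have "R.indep_sets (\<lambda>i. real_events R (\<lambda>w. w i)) (\<Union>b\<in>UNIV. I b)"
    by (rule R.indep_sets_mono_index[OF subset_UNIV])
  then have "R.indep_sets (\<lambda>b. sigma_sets (space R) (\<Union>i\<in>I b. real_events R (\<lambda>w. w i))) UNIV"
    by (rule R.indep_sets_collect_sigma)
      (auto simp: real_events_def I_def disjoint_family_on_def intro: Int_stable_preimages[where \<Omega>=UNIV, simplified])
  moreover have "B \<in> sigma_sets (space R) (\<Union>i\<in>I True. real_events R (\<lambda>w. w i))"
    using B Ufilt_generators_Pow[of R "\<lambda>k w. w k" "Suc k"] by (simp add: Ufilt_def I_def)
  moreover have "{w. w k \<in> D} \<in> sigma_sets (space R) (\<Union>i\<in>I False. real_events R (\<lambda>w. w i))"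
    using D by (intro sigma_sets.Basic) (auto simp: I_def real_events_def vimage_def)
  ultimately have "R.prob (B \<inter> {w. w k \<in> D}) = R.prob B * R.prob {w. w k \<in> D}"
    using R.indep_setsD[of _ UNIV UNIV "\<lambda>b. if b then B else {w. w k \<in> D}"]
    by (auto simp: UNIV_bool Int_commute mult.commute)
  then show ?thesis using D by (simp add: measure_R_coord)
qed

sublocale LR: pair_prob_space L R
  by (intro pair_prob_space.intro pair_sigma_finite.intro prob_space_imp_sigma_finite
      prob_space_R prob_space_axioms)

lemma prob_space_N: "prob_space N"
  unfolding N_def by (rule LR.prob_space_axioms)

lemma space_N [simp]: "space N = UNIV"
  by (simp add: N_def space_pair_measure)

text \<open>The common past of path and noise. It contains the filtrations of the path and of the
  parameters, and as a product it is generated by rectangles, on which independence and martingale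
  identities can be tested.\<close>

definition Hp :: "nat \<Rightarrow> cspace measure" where "Hp k = Gf k \<Otimes>\<^sub>M Rf k"

lemma space_Hp [simp]: "space (Hp k) = UNIV"
  by (simp add: Hp_def space_pair_measure)

lemma measurable_fst_N [measurable]: "fst \<in> measurable N L"
  by (simp add: N_def)

lemma subalgebra_Hp: "subalgebra N (Hp k)"
proof -
  have "sets (Hp k) \<subseteq> sets N"
    unfolding Hp_def N_def sets_pair_measure space_Gfilt space_Ufilt
    using subalgebra_Gf[of k] subalgebra_Rf[of k]
    by (intro sigma_sets_mono') (auto simp: subalgebra_def)
  then show ?thesis by (simp add: subalgebra_def)
qed

lemma measurable_coord_Hp: "k \<le> j \<Longrightarrow> (\<lambda>z. fst z j) \<in> measurable (Hp k) (count_space UNIV)"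
  unfolding Hp_def using measurable_fst by (rule measurable_compose) (rule measurable_coord_Gf)

lemma measurable_vert_Hp: "k \<le> j \<Longrightarrow> (\<lambda>z. vert j (fst z)) \<in> measurable (Hp k) (count_space UNIV)"
  using measurable_coord_Hp by (rule measurable_compose) simp_all

lemma measurable_lab_Hp: "k \<le> j \<Longrightarrow> (\<lambda>z. lab j (fst z)) \<in> measurable (Hp k) (count_space UNIV)"
  using measurable_coord_Hp by (rule measurable_compose) simp_all

lemma measurable_U_Hp: "k \<le> j \<Longrightarrow> U j \<in> borel_measurable (Hp k)"
proof -
  assume j: "k \<le> j"
  have "(\<lambda>z. snd z j) \<in> borel_measurable (Hp k)"
    unfolding Hp_def using measurable_snd by (rule measurable_compose) (rule measurable_Ufilt[OF j])
  then have "(\<lambda>z. override j u x (snd z j)) \<in> borel_measurable (Hp k)" for u x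
    by (rule measurable_compose) (rule measurable_override)
  then have "(\<lambda>z. override j u (fst z j) (snd z j)) \<in> borel_measurable (Hp k)" for u
    by (rule measurable_compose_countable) (rule measurable_coord_Hp[OF j])
  then have "(\<lambda>z. override j (vert (Suc j) (fst z)) (fst z j) (snd z j)) \<in> borel_measurable (Hp k)"
    by (rule measurable_compose_countable) (rule measurable_vert_Hp, use j in simp)
  then show ?thesis by (simp add: U_def[abs_def])
qed

lemma measurable_U [measurable]: "U k \<in> borel_measurable N"
  by (rule measurable_from_subalg[OF subalgebra_Hp measurable_U_Hp[OF order_refl]])

text \<open>Over a fixed path in \<open>A\<close> this is an event of the noise, where level
  \<open>k\<close> is independent of \<open>B\<close>. Averaging over the next edge by the Markov
  property gives the left side of \<open>Q_resample\<close>, hence the same value at every vertex,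
  and the three factors separate.\<close>

lemma measure_U_rect:
  assumes A: "A \<in> sets (Gf (Suc k))" and B: "B \<in> sets (Rf (Suc k))" and C: "C \<in> sets borel"
  shows "measure N ((A \<times> B) \<inter> {z. U k z \<in> C}) = prob A * measure R B * measure (Q k) C"
proof -
  interpret Nn: prob_space N by (rule prob_space_N)
  have AL [measurable]: "A \<in> sets L" using A subalgebra_Gf by (auto simp: subalgebra_def)
  have BR: "B \<in> sets R" using B subalgebra_Rf by (auto simp: subalgebra_def)
  define \<phi> where "\<phi> u x = measure (Q k) (override k u x -` C)" for u x
  have \<phi>_le: "0 \<le> \<phi> u x \<and> \<phi> u x \<le> 1" for u x
    unfolding \<phi>_def by (auto intro: prob_space.prob_le_1[OF prob_space_Q])
  have \<phi>M [measurable]: "(\<lambda>f. \<phi> (vert (Suc k) f) (f k)) \<in> borel_measurable L"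
    by (rule measurable_compose_countable[OF _ measurable_vert]) (rule measurable_compose[OF measurable_coord], simp)
  have "{z. U k z \<in> C} \<in> sets N"
    using measurable_sets[OF measurable_U C, of k] by (simp add: vimage_def)
  moreover have "A \<times> B \<in> sets N" unfolding N_def using AL BR by simp
  ultimately have X: "(A \<times> B) \<inter> {z. U k z \<in> C} \<in> sets (L \<Otimes>\<^sub>M R)"
    unfolding N_def by auto
  have sec: "emeasure R (Pair f -` ((A \<times> B) \<inter> {z. U k z \<in> C}))
      = ennreal (measure R B * (indicator A f * \<phi> (vert (Suc k) f) (f k)))" for f
  proof (cases "f \<in> A")
    case True
    then have "Pair f -` ((A \<times> B) \<inter> {z. U k z \<in> C}) = B \<inter> {w. w k \<in> override k (vert (Suc k) f) (f k) -` C}"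
      by (auto simp: U_def)
    moreover have "measure R (B \<inter> {w. w k \<in> override k (vert (Suc k) f) (f k) -` C})
        = measure R B * \<phi> (vert (Suc k) f) (f k)"
      unfolding \<phi>_def by (rule noise_indep_future[OF B override_vimage_borel[OF C]])
    ultimately show ?thesis using True by (simp only: LR.M2.emeasure_eq_measure) simp
  qed auto
  have "emeasure N ((A \<times> B) \<inter> {z. U k z \<in> C})
      = (\<integral>\<^sup>+f. ennreal (measure R B * (indicator A f * \<phi> (vert (Suc k) f) (f k))) \<partial>L)"
    unfolding N_def by (subst LR.M2.emeasure_pair_measure_alt[OF X]) (simp only: sec)
  also have "\<dots> = ennreal (\<integral>f. measure R B * (indicator A f * \<phi> (vert (Suc k) f) (f k)) \<partial>L)"
  proof (rule nn_integral_eq_integral)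
    show "integrable L (\<lambda>f. measure R B * (indicator A f * \<phi> (vert (Suc k) f) (f k)))"
      by (intro integrable_mult_right integrable_const_bound[where B=1])
        (use \<phi>_le in \<open>auto simp: indicator_def\<close>)
  qed (use \<phi>_le in auto)
  also have "(\<integral>f. measure R B * (indicator A f * \<phi> (vert (Suc k) f) (f k)) \<partial>L)
      = measure R B * (\<integral>f. indicator A f * measure_pmf.expectation (p k (vert (Suc k) f)) (\<phi> (vert (Suc k) f)) \<partial>L)"
    using markov_integral[OF A, of \<phi>] by simp
  also have "(\<integral>f. indicator A f * measure_pmf.expectation (p k (vert (Suc k) f)) (\<phi> (vert (Suc k) f)) \<partial>L)
      = (\<integral>f. indicator A f * measure (Q k) C \<partial>L)"
  proof (rule integral_cong_AE)
    have "(\<lambda>f. measure_pmf.expectation (p k (vert (Suc k) f)) (\<phi> (vert (Suc k) f))) \<in> borel_measurable L"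
      by (rule measurable_compose[OF measurable_vert]) simp
    then show "(\<lambda>f. indicator A f * measure_pmf.expectation (p k (vert (Suc k) f)) (\<phi> (vert (Suc k) f)))
        \<in> borel_measurable L" by measurable
    show "AE f in L. indicator A f * measure_pmf.expectation (p k (vert (Suc k) f)) (\<phi> (vert (Suc k) f))
        = indicator A f * measure (Q k) C"
      using AE_level[of "Suc k"] by eventually_elim (simp add: Q_resample[OF _ C] \<phi>_def[abs_def])
  qed measurable
  also have "\<dots> = prob A * measure (Q k) C" by simp
  finally show ?thesis
    by (simp add: Nn.emeasure_eq_measure mult.assoc mult.commute mult.left_commute)
qed

lemma measure_U: "C \<in> sets borel \<Longrightarrow> measure N {z. U k z \<in> C} = measure (Q k) C"
  using measure_U_rect[of UNIV k UNIV C] sets.top[of "Gf (Suc k)"] sets.top[of "Rf (Suc k)"]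
    prob_space.prob_space[OF prob_space_R] prob_space by simp

lemma distr_U: "distr N borel (U k) = Q k"
proof (rule measure_eqI)
  fix C assume "C \<in> sets (distr N borel (U k))"
  then have C: "C \<in> sets borel" by simp
  interpret Nn: prob_space N by (rule prob_space_N)
  interpret Qk: prob_space "Q k" by (rule prob_space_Q)
  show "emeasure (distr N borel (U k)) C = emeasure (Q k) C"
    using C measure_U[OF C, of k]
    by (simp add: emeasure_distr Nn.emeasure_eq_measure Qk.emeasure_eq_measure vimage_def)
qed simp

text \<open>Rectangles form a generator stable under intersection, so \<open>measure_U_rect\<close>
  suffices.\<close>

lemma indep_Hp_U: "prob_space.indep_set N (sets (Hp (Suc k))) (real_events N (U k))"
proof -
  interpret Nn: prob_space N by (rule prob_space_N)
  let ?G = "{a \<times> b |a b. a \<in> sets (Gf (Suc k)) \<and> b \<in> sets (Rf (Suc k))}"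
  have rect: "measure N (a \<times> b) = prob a * measure R b"
    if "a \<in> sets (Gf (Suc k))" "b \<in> sets (Rf (Suc k))" for a b
    using measure_U_rect[OF that, of UNIV] prob_space.prob_space[OF prob_space_Q, of k] by simp
  have "Nn.indep_set ?G (real_events N (U k))"
    unfolding Nn.indep_sets2_eq
  proof (intro conjI ballI)
    show "?G \<subseteq> Nn.events"
      using subalgebra_Gf[of "Suc k"] subalgebra_Rf[of "Suc k"] by (auto simp: N_def subalgebra_def)
    show "real_events N (U k) \<subseteq> Nn.events" by (subst real_events_subset_iff) auto
    fix a b assume "a \<in> ?G" "b \<in> real_events N (U k)"
    then obtain A B C where AB: "a = A \<times> B" "A \<in> sets (Gf (Suc k))" "B \<in> sets (Rf (Suc k))"
      and C: "C \<in> sets borel" "b = {z. U k z \<in> C}"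
      by (auto simp: real_events_def vimage_def)
    show "Nn.prob (a \<inter> b) = Nn.prob a * Nn.prob b"
      unfolding AB(1) C(2) measure_U_rect[OF AB(2,3) C(1)] rect[OF AB(2,3)] measure_U[OF C(1)] ..
  qed
  then have "Nn.indep_set (sigma_sets (space N) ?G) (sigma_sets (space N) (real_events N (U k)))"
    by (rule Nn.indep_set_sigma_sets)
      (auto simp: real_events_def intro!: Int_stable_pair_measure_generator
        intro: Int_stable_preimages[where \<Omega>=UNIV, simplified])
  moreover have "sigma_sets (space N) ?G = sets (Hp (Suc k))"
    by (simp add: Hp_def sets_pair_measure)
  moreover have "real_events N (U k) \<subseteq> sigma_sets (space N) (real_events N (U k))" by auto
  ultimately show ?thesis unfolding Nn.indep_sets2_eq by blast
qed

end

section \<open>Coupling with driven paths, generation and the parameterization property\<close>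

context backward_chain begin

abbreviation Vn :: "nat \<Rightarrow> cspace \<Rightarrow> nat" where "Vn k z \<equiv> vert k (fst z)"
abbreviation En :: "nat \<Rightarrow> cspace \<Rightarrow> nat" where "En k z \<equiv> lab k (fst z)"
abbreviation GN :: "nat \<Rightarrow> cspace measure" where "GN \<equiv> Gfilt N Vn En"
abbreviation Uf :: "nat \<Rightarrow> cspace measure" where "Uf \<equiv> Ufilt N U"

lemma measurable_Vn [measurable]: "Vn k \<in> measurable N (count_space UNIV)"
  by (rule measurable_compose[OF measurable_fst_N measurable_vert])

lemma measurable_En [measurable]: "En k \<in> measurable N (count_space UNIV)"
  by (rule measurable_compose[OF measurable_fst_N measurable_lab])

lemma distr_fst_N: "distr N L fst = L"
  unfolding N_def by (rule LR.M2.distr_pair_fst)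

lemma AE_N_fst: "AE f in L. P f \<Longrightarrow> AE z in N. P (fst z)"
  by (rule AE_distrD[OF measurable_fst_N]) (simp only: distr_fst_N)

lemma subalgebra_GN: "subalgebra N (GN k)"
  by (intro subalgebra_Gfilt measurable_Vn measurable_En)

lemma subalgebra_Uf: "subalgebra N (Uf k)"
  by (intro subalgebra_Ufilt measurable_U)

lemma sets_GN_subset_Hp: "sets (GN k) \<subseteq> sets (Hp k)"
  by (rule sets_Gfilt_subset) (auto intro: measurable_vert_Hp measurable_lab_Hp)

lemma sets_Uf_subset_Hp: "sets (Uf k) \<subseteq> sets (Hp k)"
  by (rule sets_Ufilt_subset) (auto intro: measurable_U_Hp)

text \<open>The given path obeys the same recursion as a path driven by the parameters alone; this
  is what allows the two to be compared step by step.\<close>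

lemma AE_step: "AE z in N. fst z k = decode (U k z) (Vn (Suc k) z)"
  using AE_N_fst[OF AE_level[of "Suc k"]]
  by eventually_elim (simp add: U_def decode_override)

lemma AE_Q_support: "AE t in Q k. \<forall>u\<le>Suc k. decode t u \<in> set_pmf (p k u)"
proof -
  define P where "P t \<longleftrightarrow> (\<forall>u\<le>Suc k. decode t u \<in> set_pmf (p k u))" for t
  have "{t. P t} = (\<Inter>u\<in>{..Suc k}. (\<lambda>t. decode t u) -` set_pmf (p k u) \<inter> space borel)"
    by (auto simp: P_def)
  also have "\<dots> \<in> sets borel"
    by (intro sets.finite_INT measurable_sets[OF measurable_decode]) auto
  finally have meas: "{t. P t} \<in> sets borel" .
  have "g u \<in> set_pmf (p k u)" if "g \<in> set_pmf (noise k)" "u \<le> Suc k" for g u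
    using that by (auto simp: noise_def set_Pi_pmf PiE_dflt_def)
  then have "AE g in noise k. P (encode k g)"
    by (simp add: AE_measure_pmf_iff decode_encode P_def)
  moreover have "(AE t in Q k. P t) \<longleftrightarrow> (AE g in noise k. P (encode k g))"
    unfolding Q_def by (rule AE_distr_iff) (simp_all add: meas)
  ultimately have "AE t in Q k. P t" by (rule iffD2[rotated])
  then show ?thesis unfolding P_def .
qed

lemma AE_U_support: "AE z in N. \<forall>u\<le>Suc k. decode (U k z) u \<in> set_pmf (p k u)"
  by (rule AE_distrD[OF measurable_U[of k]]) (simp only: distr_U AE_Q_support)

lemma integral_Q_decode:
  fixes \<phi> :: "nat \<times> nat \<Rightarrow> real"
  assumes "u \<le> Suc k"
  shows "(\<integral>t. \<phi> (decode t u) \<partial>Q k) = measure_pmf.expectation (p k u) \<phi>"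
proof -
  have "(\<lambda>t. \<phi> (decode t u)) \<in> borel_measurable borel"
    by (rule measurable_compose[OF measurable_decode]) simp
  then have "(\<integral>t. \<phi> (decode t u) \<partial>Q k) = measure_pmf.expectation (noise k) (\<lambda>g. \<phi> (g u))"
    unfolding Q_def using assms by (subst integral_distr) (auto simp: decode_encode)
  also have "\<dots> = measure_pmf.expectation (map_pmf (\<lambda>g. g u) (noise k)) \<phi>" by simp
  finally show ?thesis by (simp add: noise_component[OF assms])
qed

text \<open>Since one step lowers the vertex by at most one, two copies driven by the same noise never cross; this
  makes the coupling optimal for monotone functions.\<close>

lemma coupling_one_step:
  fixes h :: "nat \<Rightarrow> real"
  assumes h: "mono h" "\<And>v. 0 \<le> h v \<and> h v \<le> 1" and "a \<le> Suc k" "b \<le> Suc k"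
  shows "(\<integral>t. \<bar>h (fst (decode t a)) - h (fst (decode t b))\<bar> \<partial>Q k) = \<bar>transition k h a - transition k h b\<bar>"
  using assms(3,4)
proof (induction a b rule: linorder_wlog)
  case (sym a b)
  then show ?case by (simp add: abs_minus_commute)
next
  case (le a b)
  interpret Qk: prob_space "Q k" by (rule prob_space_Q)
  have M: "(\<lambda>t. h (fst (decode t u))) \<in> borel_measurable (Q k)" for u
    using measurable_compose[OF measurable_decode, of "\<lambda>x. h (fst x)" borel u]
    by (simp add: measurable_cong_sets[OF sets_Q refl])
  have int: "integrable (Q k) (\<lambda>t. h (fst (decode t u)))" for u
    by (rule Qk.integrable_const_bound[where B=1]) (use h(2) M in auto)
  have "(\<integral>t. \<bar>h (fst (decode t a)) - h (fst (decode t b))\<bar> \<partial>Q k)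
      = (\<integral>t. h (fst (decode t b)) - h (fst (decode t a)) \<partial>Q k)"
  proof (rule integral_cong_AE)
    show "AE t in Q k. \<bar>h (fst (decode t a)) - h (fst (decode t b))\<bar> = h (fst (decode t b)) - h (fst (decode t a))"
      using AE_Q_support[of k]
    proof eventually_elim
      case (elim t)
      have "fst (decode t a) \<le> fst (decode t b)"
      proof (cases "a = b")
        case False
        \<comment> \<open>For \<open>a < b\<close> the step from \<open>a\<close> ends at most at
          \<open>a \<le> b - 1\<close> and the step from \<open>b\<close> at least at
          \<open>b - 1\<close>. For \<open>a = b\<close> both read the same entry.\<close>
        have "fst (decode t a) \<le> a" "b \<le> Suc (fst (decode t b))" using elim le p_step by blast+
        then show ?thesis using False le(1) by simp
      qed simp
      then show ?case using monoD[OF h(1)] by simp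
    qed
  qed (use M in auto)
  also have "\<dots> = transition k h b - transition k h a"
    using int integral_Q_decode[of _ k "\<lambda>x. h (fst x)"] le by (simp add: transition_def)
  also have "\<dots> = \<bar>transition k h a - transition k h b\<bar>"
    using monoD[OF mono_transition[OF h(1)] le(1)] by simp
  finally show ?case .
qed

text \<open>The path started at vertex \<open>v\<close> of level \<open>k+d\<close> and driven by the parameters only, evaluated at
  level \<open>k\<close>.\<close>

fun driven :: "nat \<Rightarrow> nat \<Rightarrow> nat \<Rightarrow> cspace \<Rightarrow> nat" where
  "driven k 0 v z = v"
| "driven k (Suc d) v z = fst (decode (U k z) (driven (Suc k) d v z))"

lemma measurable_driven: "driven k d v \<in> measurable (Uf k) (count_space UNIV)"
proof (induction d arbitrary: k)
  case (Suc d)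
  have "subalgebra (Uf k) (Uf (Suc k))" using sets_Ufilt_antimono[of k "Suc k" N U] by (simp add: subalgebra_def)
  from measurable_from_subalg[OF this Suc]
  have IH: "driven (Suc k) d v \<in> measurable (Uf k) (count_space UNIV)" .
  have "(\<lambda>z. fst (decode (U k z) u)) \<in> measurable (Uf k) (count_space UNIV)" for u
    using measurable_compose[OF measurable_compose[OF measurable_Ufilt[OF order_refl] measurable_decode],
      of fst "count_space UNIV"] by simp
  then have "(\<lambda>z. fst (decode (U k z) (driven (Suc k) d v z))) \<in> measurable (Uf k) (count_space UNIV)"
    by (rule measurable_compose_countable) (rule IH)
  then show ?case by simp
next
  case 0
  have "driven k 0 v = (\<lambda>_. v)" by (rule ext) simp
  then show ?case by simp
qed

lemma measurable_driven_N: "driven k d v \<in> measurable N (count_space UNIV)"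
  by (rule measurable_from_subalg[OF subalgebra_Uf measurable_driven])

text \<open>Only almost sure, because a real outside the support of the noise may decode to a vertex
  beyond the level.\<close>

lemma AE_driven_level: "v \<le> k + d \<Longrightarrow> AE z in N. driven k d v z \<le> k"
proof (induction d arbitrary: k)
  case (Suc d)
  then have "AE z in N. driven (Suc k) d v z \<le> Suc k" by simp
  with AE_U_support[of k] show ?case
    by eventually_elim (auto intro: p_level)
qed simp

text \<open>Given level \<open>k+1\<close>, the mean over \<open>U k\<close> is computed exactly by
  \<open>coupling_one_step\<close>, which replaces \<open>h\<close> by
  \<open>transition k h\<close>. This function is again monotone with values between 0 and 1, so the
  induction continues until the driven path sits at its start \<open>v\<close>.\<close>

lemma coupling:
  fixes h :: "nat \<Rightarrow> real"
  assumes "mono h" "\<And>v. 0 \<le> h v \<and> h v \<le> 1" "v \<le> k + d"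
  shows "(\<integral>z. \<bar>h (Vn k z) - h (driven k d v z)\<bar> \<partial>N)
       = (\<integral>f. \<bar>transitions k d h (vert (k + d) f) - transitions k d h v\<bar> \<partial>L)"
  using assms
proof (induction d arbitrary: k h)
  case 0
  have "(\<lambda>f. \<bar>h (vert k f) - h v\<bar>) \<in> borel_measurable L"
    by (rule measurable_compose[OF measurable_vert, where g="\<lambda>u. \<bar>h u - h v\<bar>"]) simp
  then have "(\<integral>f. \<bar>h (vert k f) - h v\<bar> \<partial>distr N L fst) = (\<integral>z. \<bar>h (Vn k z) - h v\<bar> \<partial>N)"
    by (intro integral_distr) auto
  then show ?case by (simp add: distr_fst_N)
next
  case (Suc d)
  interpret Nn: prob_space N by (rule prob_space_N)
  \<comment> \<open>The pair of current vertices is a function of the common past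
    \<open>Hp (Suc k)\<close> with almost surely finitely many values, hence independent of
    \<open>U k\<close> and accessible to \<open>integral_indep_discrete\<close>.\<close>
  define X where "X z = (Vn (Suc k) z, driven (Suc k) d v z)" for z
  define \<psi> where "\<psi> ab t = \<bar>h (fst (decode t (fst ab))) - h (fst (decode t (snd ab)))\<bar>" for ab :: "nat \<times> nat" and t
  have driven_Hp: "driven (Suc k) d v \<in> measurable (Hp (Suc k)) (count_space UNIV)"
    using measurable_driven[of "Suc k" d v] sets_Uf_subset_Hp[of "Suc k"]
    by (auto intro: measurable_from_subalg[of "Hp (Suc k)" "Uf (Suc k)"] simp: subalgebra_def)
  have "(\<lambda>z. (a, driven (Suc k) d v z)) \<in> measurable (Hp (Suc k)) (count_space UNIV)" for a :: nat
    by (rule measurable_compose[OF driven_Hp]) simp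
  then have XH: "X \<in> measurable (Hp (Suc k)) (count_space UNIV)"
    unfolding X_def by (rule measurable_compose_countable) (rule measurable_vert_Hp, simp)
  have XN: "X \<in> measurable N (count_space UNIV)"
    by (rule measurable_from_subalg[OF subalgebra_Hp XH])
  have XS: "AE z in N. X z \<in> {..Suc k} \<times> {..Suc k}"
  proof -
    have "AE z in N. driven (Suc k) d v z \<le> Suc k" using Suc.prems by (intro AE_driven_level) simp
    with AE_N_fst[OF AE_level[of "Suc k"]] show ?thesis
      by eventually_elim (simp add: X_def)
  qed
  have hM: "(\<lambda>t. h (fst (decode t u))) \<in> borel_measurable borel" for u
    by (rule measurable_compose[OF measurable_decode, where g="\<lambda>x. h (fst x)"]) simp
  have \<psi>M: "\<psi> ab \<in> borel_measurable borel" for ab unfolding \<psi>_def using hM by measurable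
  have \<psi>b: "\<bar>\<psi> ab t\<bar> \<le> 1" for ab t
    unfolding \<psi>_def using Suc.prems(2)[of "fst (decode t (fst ab))"] Suc.prems(2)[of "fst (decode t (snd ab))"] by auto
  have "(\<integral>z. \<bar>h (Vn k z) - h (driven k (Suc d) v z)\<bar> \<partial>N) = (\<integral>z. \<psi> (X z) (U k z) \<partial>N)"
  proof (rule integral_cong_AE)
    have "(\<lambda>z. h (Vn k z)) \<in> borel_measurable N" "(\<lambda>z. h (driven k (Suc d) v z)) \<in> borel_measurable N"
      by (rule measurable_compose[OF measurable_Vn] measurable_compose[OF measurable_driven_N], simp)+
    then show "(\<lambda>z. \<bar>h (Vn k z) - h (driven k (Suc d) v z)\<bar>) \<in> borel_measurable N" by measurable
    show "(\<lambda>z. \<psi> (X z) (U k z)) \<in> borel_measurable N"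
      by (rule measurable_compose_countable[OF measurable_compose[OF measurable_U \<psi>M] XN])
    show "AE z in N. \<bar>h (Vn k z) - h (driven k (Suc d) v z)\<bar> = \<psi> (X z) (U k z)"
      using AE_step[of k] by eventually_elim (simp add: \<psi>_def X_def)
  qed
  also have "\<dots> = (\<integral>z. \<integral>t. \<psi> (X z) t \<partial>distr N borel (U k) \<partial>N)"
    by (rule Nn.integral_indep_discrete[OF subalgebra_Hp XH _ XS measurable_U indep_Hp_U \<psi>M \<psi>b]) simp
  also have "\<dots> = (\<integral>z. \<bar>transition k h (Vn (Suc k) z) - transition k h (driven (Suc k) d v z)\<bar> \<partial>N)"
  proof (rule integral_cong_AE)
    show "(\<lambda>z. \<integral>t. \<psi> (X z) t \<partial>distr N borel (U k)) \<in> borel_measurable N"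
      by (rule measurable_compose[OF XN]) simp
    have "(\<lambda>z. transition k h (Vn (Suc k) z)) \<in> borel_measurable N"
      "(\<lambda>z. transition k h (driven (Suc k) d v z)) \<in> borel_measurable N"
      by (rule measurable_compose[OF measurable_Vn] measurable_compose[OF measurable_driven_N], simp)+
    then show "(\<lambda>z. \<bar>transition k h (Vn (Suc k) z) - transition k h (driven (Suc k) d v z)\<bar>) \<in> borel_measurable N"
      by measurable
    show "AE z in N. (\<integral>t. \<psi> (X z) t \<partial>distr N borel (U k))
        = \<bar>transition k h (Vn (Suc k) z) - transition k h (driven (Suc k) d v z)\<bar>"
      using XS
    proof eventually_elim
      case (elim z)
      then show ?case
        using coupling_one_step[OF Suc.prems(1,2), of "Vn (Suc k) z" k "driven (Suc k) d v z"]
        by (simp add: \<psi>_def X_def distr_U)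
    qed
  qed
  also have "\<dots> = (\<integral>f. \<bar>transitions (Suc k) d (transition k h) (vert (Suc k + d) f) - transitions (Suc k) d (transition k h) v\<bar> \<partial>L)"
    using Suc.prems(3) transitions_bounds[OF Suc.prems(2), of k "Suc 0"]
    by (intro Suc.IH mono_transition[OF Suc.prems(1)]) auto
  finally show ?case by simp
qed

text \<open>For the indicator \<open>h\<close> of \<open>{x..}\<close>,
  \<open>\<bar>h (Vn k z) - h (driven k d v z)\<bar>\<close> is the indicator of a symmetric
  difference of events. By \<open>coupling\<close> its mean is the deviation that
  \<open>mixing\<close> makes small, and the event of the driven path belongs to the
  parameters.\<close>

lemma vertex_in_null_completion:
  "{z. x \<le> Vn k z} \<in> sets (null_completion N (Uf k))"
proof -
  interpret Nn: prob_space N by (rule prob_space_N)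
  define h where "h v = (of_bool (x \<le> v) :: real)" for v
  have h: "mono h" "\<And>v. 0 \<le> h v \<and> h v \<le> 1" by (auto simp: h_def mono_def)
  have ev: "{z. x \<le> Vn k z} \<in> sets N"
    using measurable_sets[OF measurable_Vn, of "{x..}" k] by (simp add: vimage_def)
  show ?thesis
  proof (rule Nn.null_completionI_approx[OF subalgebra_Uf ev])
    fix e :: real assume "e > 0"
    from mixing[where h=h and k=k, OF h(2) this] obtain d v where v: "v \<le> k + d"
      and e: "(\<integral>f. \<bar>transitions k d h (vert (k + d) f) - transitions k d h v\<bar> \<partial>L) < e"
      by (elim exE conjE)
    define B where "B = {z. x \<le> driven k d v z}"
    have BU: "B \<in> sets (Uf k)"
      using measurable_sets[OF measurable_driven, of "{x..}" k d v] by (simp add: vimage_def B_def)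
    have "Nn.prob (({z. x \<le> Vn k z} - B) \<union> (B - {z. x \<le> Vn k z}))
        = (\<integral>z. indicator (({z. x \<le> Vn k z} - B) \<union> (B - {z. x \<le> Vn k z})) z \<partial>N)"
      by simp
    also have "\<dots> = (\<integral>z. \<bar>h (Vn k z) - h (driven k d v z)\<bar> \<partial>N)"
      by (intro Bochner_Integration.integral_cong) (auto simp: B_def h_def indicator_def)
    also have "\<dots> < e" using coupling[where h=h, OF h v] e by simp
    finally show "\<exists>B\<in>sets (Uf k). Nn.prob (({z. x \<le> Vn k z} - B) \<union> (B - {z. x \<le> Vn k z})) < e"
      using BU by blast
  qed
qed

lemma measurable_Vn_null_completion:
  assumes "k \<le> j"
  shows "Vn j \<in> measurable (null_completion N (Uf k)) (count_space UNIV)"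
proof (rule measurable_null_completion_mono[OF subalgebra_Uf subalgebra_Uf sets_Ufilt_antimono[OF assms]])
  have "{z. Vn j z = n} \<in> sets (null_completion N (Uf j))" for n
  proof -
    have "{z. Vn j z = n} = {z. n \<le> Vn j z} - {z. Suc n \<le> Vn j z}" by auto
    then show ?thesis using vertex_in_null_completion by (metis sets.Diff)
  qed
  then show "Vn j \<in> measurable (null_completion N (Uf j)) (count_space UNIV)"
    by (subst measurable_count_space_eq2_countable) (auto simp: vimage_def)
qed

text \<open>One step of the recursion inside any \<open>H\<close> that knows \<open>U k\<close> and,
  up to null sets, the vertex at \<open>Suc k\<close>. It serves both generation, with
  \<open>H\<close> the parameter filtration, and the parameterization property, with
  \<open>H\<close> the past joined with \<open>U k\<close>.\<close>

lemma measurable_step: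
  assumes H: "subalgebra N H" "U k \<in> borel_measurable H"
    and V: "Vn (Suc k) \<in> measurable (null_completion N H) (count_space UNIV)"
  shows "Vn k \<in> measurable (null_completion N H) (count_space UNIV)"
    and "En k \<in> measurable (null_completion N H) (count_space UNIV)"
proof -
  have "(\<lambda>z. decode (U k z) u) \<in> measurable (null_completion N H) (count_space UNIV)" for u
    using measurable_compose[OF measurable_null_completionI[OF H] measurable_decode] .
  from measurable_compose_countable[OF this V]
  have D: "(\<lambda>z. decode (U k z) (Vn (Suc k) z)) \<in> measurable (null_completion N H) (count_space UNIV)" .
  have "AE z in N. fst (decode (U k z) (Vn (Suc k) z)) = Vn k z"
    "AE z in N. snd (decode (U k z) (Vn (Suc k) z)) = En k z"
    using AE_step[of k] by (eventually_elim, simp)+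
  then show "Vn k \<in> measurable (null_completion N H) (count_space UNIV)"
    "En k \<in> measurable (null_completion N H) (count_space UNIV)"
    by (auto intro!: measurable_null_completion_AE_cong[OF H(1) measurable_compose[OF D]])
qed

lemma sets_GN_subset_null_completion: "sets (GN k) \<subseteq> sets (null_completion N (Uf k))"
proof (rule sets_Gfilt_subset)
  show "Vn j \<in> measurable (null_completion N (Uf k)) (count_space UNIV)" if "k \<le> j" for j
    by (rule measurable_Vn_null_completion[OF that])
  show "En j \<in> measurable (null_completion N (Uf k)) (count_space UNIV)" if "k \<le> j" for j
    using that by (intro measurable_step(2)[OF subalgebra_Uf measurable_Ufilt] measurable_Vn_null_completion) auto
qed simp

lemma generating: "is_generating N Vn En U"
  unfolding is_generating_def
  using sets_GN_subset_null_completion subalgebra_GN subalgebra_Uf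
  by (auto simp: subalg_null_iff_null_completion subalgebra_def)

lemma parameterization: "is_parameterization N Vn En U"
  unfolding is_parameterization_def
proof (intro conjI allI)
  interpret Nn: prob_space N by (rule prob_space_N)
  fix k
  show "U k \<in> borel_measurable N" by simp
  let ?S = "sets (GN (Suc k)) \<union> (\<Union>j\<in>{Suc k..}. real_events N (U j))"
  \<comment> \<open>The parameters of index above \<open>k\<close> are functions of path and noise
    from level \<open>Suc k\<close> on, so \<open>indep_Hp_U\<close> covers them together with the
    past of the path.\<close>
  have S: "?S \<subseteq> sets (Hp (Suc k))"
    using sets_GN_subset_Hp[of "Suc k"]
      real_events_subset_iff[of "Hp (Suc k)" N] measurable_U_Hp[of "Suc k"]
    by (intro Un_least UN_least) auto
  then have "sets (sigma (space N) ?S) \<subseteq> sets (Hp (Suc k))"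
    using sets.sigma_sets_subset[OF S] by simp
  then show "Nn.indep_set (sets (sigma (space N) ?S)) (real_events N (U k))"
    using indep_Hp_U[of k] unfolding Nn.indep_sets2_eq by blast
  let ?T = "sets (GN (Suc k)) \<union> real_events N (U k)"
  let ?H = "sigma (space N) ?T"
  have T: "?T \<subseteq> sets N"
    using subalgebra_GN[of "Suc k"] real_events_subset_iff[of N N "U k"] by (simp add: subalgebra_def)
  have TH: "?T \<subseteq> sets ?H" by (auto intro: sigma_sets.Basic)
  have H: "subalgebra N ?H"
    using sets.sigma_sets_subset[OF T] by (simp add: subalgebra_def)
  have GH: "subalgebra ?H (GN (Suc k))" using TH by (simp add: subalgebra_def)
  have UH: "U k \<in> borel_measurable ?H"
    using TH by (subst real_events_subset_iff[symmetric, where M=N]) auto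
  have VH: "Vn j \<in> measurable (null_completion N ?H) (count_space UNIV)"
    "En j \<in> measurable (null_completion N ?H) (count_space UNIV)" if "Suc k \<le> j" for j
    by (rule measurable_null_completionI[OF H measurable_from_subalg[OF GH measurable_Gfilt(1)[OF that]]]
        measurable_null_completionI[OF H measurable_from_subalg[OF GH measurable_Gfilt(2)[OF that]]])+
  \<comment> \<open>Only index \<open>k\<close> is new: the other coordinates are measurable for
    \<open>GN (Suc k)\<close>, and the edge at \<open>k\<close> is read off the parameter at the
    vertex \<open>Vn (Suc k)\<close>.\<close>
  have "sets (GN k) \<subseteq> sets (null_completion N ?H)"
  proof (rule sets_Gfilt_subset)
    show "Vn j \<in> measurable (null_completion N ?H) (count_space UNIV)"
      "En j \<in> measurable (null_completion N ?H) (count_space UNIV)" if "k \<le> j" for j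
      using VH(1)[of j] VH(2)[of j] measurable_step[OF H UH VH(1)[OF order_refl]] that
      by (cases "j = k"; simp)+
  qed simp
  then show "subalg_null N (GN k) ?H"
    using H subalgebra_GN[of k] by (subst subalg_null_iff_null_completion) (auto simp: subalgebra_def)
qed

end

section \<open>Immersion\<close>

context backward_chain begin

text \<open>The level set of \<open>X\<close> through \<open>z\<close> is a preimage under
  \<open>fst\<close>, hence contains the whole fibre of \<open>z\<close>. The identity holds
  everywhere, without null sets.\<close>

lemma GN_measurable_factor:
  fixes X :: "cspace \<Rightarrow> real"
  assumes X: "X \<in> borel_measurable (GN k)"
  shows "X z = X (fst z, w)"
proof -
  let ?F = "vimage_algebra UNIV fst (count_space UNIV) :: cspace measure"
  have F: "fst \<in> measurable ?F (count_space UNIV)" by (rule measurable_vimage_algebra1) simp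
  have "sets (GN k) \<subseteq> sets ?F"
    by (rule sets_Gfilt_subset) (auto intro: measurable_compose[OF F])
  moreover have "X -` {X z} \<inter> space (GN k) \<in> sets (GN k)"
    by (rule measurable_sets[OF X]) simp
  ultimately have "X -` {X z} \<in> sets ?F" by auto
  then obtain A where "X -` {X z} = fst -` A" by (auto simp: sets_vimage_algebra2)
  moreover have "z \<in> X -` {X z}" by simp
  ultimately have "(fst z, w) \<in> X -` {X z}" by simp
  then show ?thesis by simp
qed

text \<open>\<open>X\<close> depends on the path alone and the noise is independent of it, so Fubini
  splits off the factor of \<open>b\<close>. The sequence \<open>\<lambda>_. 0\<close> in the proof
  is an arbitrary reference point for the second coordinate.\<close>

lemma integral_rect_GN:
  fixes X :: "cspace \<Rightarrow> real"
  assumes X: "X \<in> borel_measurable (GN k)" and int: "integrable N X"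
    and a: "a \<in> sets L" and b: "b \<in> sets R"
  shows "(\<integral>z. indicator (a \<times> b) z * X z \<partial>N) = measure R b * (\<integral>z. indicator (a \<times> UNIV) z * X z \<partial>N)"
proof -
  have I: "(\<integral>z. indicator (a \<times> c) z * X z \<partial>N)
      = measure R c * (\<integral>f. indicator a f * X (f, \<lambda>_. 0) \<partial>L)" if c: "c \<in> sets R" for c
  proof -
    have "a \<times> c \<in> sets N" unfolding N_def using a c by simp
    then have "integrable (L \<Otimes>\<^sub>M R) (\<lambda>z. indicator (a \<times> c) z * X z)"
      using integrable_mult_indicator[OF _ int, of "a \<times> c"] by (simp add: N_def)
    from LR.integral_fst'[OF this]
    have "(\<integral>z. indicator (a \<times> c) z * X z \<partial>N)
        = (\<integral>f. \<integral>w. indicator (a \<times> c) (f, w) * X (f, w) \<partial>R \<partial>L)" by (simp add: N_def)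
    also have "\<dots> = (\<integral>f. \<integral>w. indicator c w * (indicator a f * X (f, \<lambda>_. 0)) \<partial>R \<partial>L)"
    proof -
      have "X (f, w) = X (f, \<lambda>_. 0)" for f w using GN_measurable_factor[OF X, of "(f, w)" "\<lambda>_. 0"] by simp
      then show ?thesis
        by (intro Bochner_Integration.integral_cong refl) (auto simp: indicator_def)
    qed
    also have "\<dots> = (\<integral>f. measure R c * (indicator a f * X (f, \<lambda>_. 0)) \<partial>L)"
      using c by simp
    finally show ?thesis by simp
  qed
  have "measure R UNIV = 1" using prob_space.prob_space[OF prob_space_R] by simp
  moreover have "UNIV \<in> sets R" using sets.top[of R] by simp
  ultimately show ?thesis using I[OF b] I[of UNIV] by simp
qed

text \<open>The extra noise does not help to predict the path. On a rectangle the noise splits off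
  by \<open>integral_rect_GN\<close> and leaves an event of the path filtration, where the
  martingale property applies; a Dynkin argument extends this to all of
  \<open>Hp (Suc k)\<close>.\<close>

lemma martingale_integral_Hp:
  fixes X :: "nat \<Rightarrow> cspace \<Rightarrow> real"
  assumes X: "martingale_rev N GN X" and A: "A \<in> sets (Hp (Suc k))"
  shows "(\<integral>z\<in>A. X k z \<partial>N) = (\<integral>z\<in>A. X (Suc k) z \<partial>N)"
proof -
  interpret Nn: prob_space N by (rule prob_space_N)
  interpret S: sigma_finite_subalgebra N "GN (Suc k)"
    by (rule Nn.sigma_finite_subalgebraI[OF subalgebra_GN])
  have int: "integrable N (X j)" and meas: "X j \<in> borel_measurable (GN j)" for j
    using X by (auto simp: martingale_rev_def)
  define D where "D z = X k z - X (Suc k) z" for z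
  have Dint: "integrable N D" unfolding D_def using int by simp
  have "subalgebra (GN k) (GN (Suc k))"
    using sets_Gfilt_antimono[of k "Suc k" N Vn En] by (simp add: subalgebra_def)
  then have "X (Suc k) \<in> borel_measurable (GN k)" by (rule measurable_from_subalg[OF _ meas])
  then have DG: "D \<in> borel_measurable (GN k)" unfolding D_def using meas[of k] by measurable
  have D0: "(\<integral>z. indicator B z * D z \<partial>N) = 0" if B: "B \<in> sets (GN (Suc k))" for B
  proof -
    have BN: "B \<in> sets N" using B subalgebra_GN by (auto simp: subalgebra_def)
    have i: "integrable N (\<lambda>z. indicator B z * X j z)" for j
      using integrable_mult_indicator[OF BN int] by simp
    have "(\<integral>z\<in>B. X k z \<partial>N) = (\<integral>z\<in>B. real_cond_exp N (GN (Suc k)) (X k) z \<partial>N)"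
      by (rule S.real_cond_exp_intA[OF int B])
    also have "\<dots> = (\<integral>z\<in>B. X (Suc k) z \<partial>N)"
    proof -
      have "AE z in N. real_cond_exp N (GN (Suc k)) (X k) z = X (Suc k) z"
        using X by (auto simp: martingale_rev_def)
      then show ?thesis
        unfolding set_lebesgue_integral_def using BN int[of "Suc k"]
        by (intro integral_cong_AE) auto
    qed
    finally show ?thesis
      unfolding D_def set_lebesgue_integral_def using i by (simp add: right_diff_distrib)
  qed
  let ?G = "{a \<times> b |a b. a \<in> sets (Gf (Suc k)) \<and> b \<in> sets (Rf (Suc k))}"
  have G: "sets (Hp (Suc k)) = sigma_sets UNIV ?G" by (simp add: Hp_def sets_pair_measure)
  have HN: "sets (Hp (Suc k)) \<subseteq> sets N" using subalgebra_Hp by (auto simp: subalgebra_def)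
  have Di: "integrable N (\<lambda>z. indicator B z * D z)" if "B \<in> sets (Hp (Suc k))" for B
    using integrable_mult_indicator[OF subsetD[OF HN that] Dint] by simp
  have "Int_stable ?G" by (rule Int_stable_pair_measure_generator)
  moreover have "?G \<subseteq> Pow UNIV" by simp
  moreover have "A \<in> sigma_sets UNIV ?G" using A G by simp
  ultimately have "(\<integral>z. indicator A z * D z \<partial>N) = 0"
  proof (induction rule: sigma_sets_induct_disjoint)
    case (basic B)
    then obtain a b where B: "B = a \<times> b" "a \<in> sets (Gf (Suc k))" "b \<in> sets (Rf (Suc k))" by auto
    then have aL: "a \<in> sets L" and bR: "b \<in> sets R"
      using subalgebra_Gf subalgebra_Rf by (auto simp: subalgebra_def)
    have fst_vim: "fst -` a = a \<times> (UNIV :: (nat \<Rightarrow> real) set)" by auto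
    have "fst \<in> measurable (GN (Suc k)) (Gf (Suc k))"
      by (intro measurable_into_Gfilt measurable_Gfilt[where M=N and V=Vn and E=En]) auto
    from measurable_sets[OF this B(2)] have "a \<times> UNIV \<in> sets (GN (Suc k))"
      by (simp add: fst_vim)
    then show ?case
      unfolding B(1) integral_rect_GN[OF DG Dint aL bR] by (simp add: D0)
  next
    case (compl B)
    then have B: "B \<in> sets (Hp (Suc k))" using G by simp
    have "(\<integral>z. indicator (UNIV - B) z * D z \<partial>N) = (\<integral>z. D z - indicator B z * D z \<partial>N)"
      by (intro Bochner_Integration.integral_cong refl) (auto simp: indicator_def)
    also have "\<dots> = (\<integral>z. D z \<partial>N)" using Dint Di[OF B] compl.IH by simp
    also have "\<dots> = 0" using D0[of UNIV] sets.top[of "GN (Suc k)"] by simp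
    finally show ?case .
  next
    case (union B)
    have B: "B i \<in> sets N" for i using union.hyps G HN by auto
    have UB: "(\<Union>i. B i) \<in> sets N" using B by auto
    have "(\<integral>z\<in>(\<Union>i. B i). D z \<partial>N) = (\<Sum>i. (\<integral>z\<in>B i. D z \<partial>N))"
    proof (rule lebesgue_integral_countable_add[OF B])
      show "i \<noteq> j \<Longrightarrow> B i \<inter> B j = {}" for i j
        using union.hyps(1) by (auto simp: disjoint_family_on_def)
      show "set_integrable N (\<Union>i. B i) D"
        unfolding set_integrable_def by (rule integrable_mult_indicator[OF UB Dint])
    qed
    then show ?case using union.IH by (simp add: set_lebesgue_integral_def)
  qed simp
  moreover have "integrable N (\<lambda>z. indicator A z * X j z)" for j
    using integrable_mult_indicator[OF subsetD[OF HN A] int] by simp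
  ultimately show ?thesis
    unfolding D_def set_lebesgue_integral_def by (simp add: right_diff_distrib)
qed

text \<open>A martingale is only measurable for the null completion of the parameter filtration, hence the
  conditional expectation is first computed for the join of both filtrations.\<close>

lemma immersion: "immersed N GN Uf"
  unfolding immersed_def
proof (intro conjI allI impI)
  interpret Nn: prob_space N by (rule prob_space_N)
  show "subalg_null N (GN k) (Uf k)" for k
    using generating by (simp add: is_generating_def)
  fix X :: "nat \<Rightarrow> cspace \<Rightarrow> real" and k assume X: "martingale_rev N GN X"
  have int: "integrable N (X j)" and meas: "X j \<in> borel_measurable (GN j)" for j
    using X by (auto simp: martingale_rev_def)
  let ?S = "sets (GN (Suc k)) \<union> sets (Uf (Suc k))"
  define J where "J = sigma UNIV ?S"
  have "?S \<subseteq> sets J" unfolding J_def by (auto intro: sigma_sets.Basic)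
  have J_le: "sets J \<subseteq> sets F" if "?S \<subseteq> sets F" "space F = UNIV" for F :: "cspace measure"
    using sets.sigma_sets_subset[OF that(1)] that(2) by (simp add: J_def)
  have spJ: "space J = UNIV" by (simp add: J_def)
  have JN: "subalgebra N J"
    using J_le[of N] subalgebra_GN[of "Suc k"] subalgebra_Uf[of "Suc k"] spJ by (auto simp: subalgebra_def)
  \<comment> \<open>Two bounds on \<open>J\<close> are used: inside \<open>Hp (Suc k)\<close> the
    martingale identity is available, and inside the null completion conditioning on
    \<open>J\<close> agrees with conditioning on the parameters.\<close>
  have JH: "sets J \<subseteq> sets (Hp (Suc k))"
    using J_le[of "Hp (Suc k)"] sets_GN_subset_Hp sets_Uf_subset_Hp by simp
  have Jnull: "sets J \<subseteq> sets (null_completion N (Uf (Suc k)))"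
    by (rule J_le) (simp_all add: sets_GN_subset_null_completion sets_subset_null_completion[OF subalgebra_Uf])
  interpret S: sigma_finite_subalgebra N J by (rule Nn.sigma_finite_subalgebraI[OF JN])
  have "AE z in N. real_cond_exp N J (X k) z = X (Suc k) z"
  proof (rule S.real_cond_exp_charact[OF _ int int])
    show "(\<integral>z\<in>A. X k z \<partial>N) = (\<integral>z\<in>A. X (Suc k) z \<partial>N)" if "A \<in> sets J" for A
      using martingale_integral_Hp[OF X] that JH by auto
    have "subalgebra J (GN (Suc k))" using \<open>?S \<subseteq> sets J\<close> spJ by (simp add: subalgebra_def)
    then show "X (Suc k) \<in> borel_measurable J" by (rule measurable_from_subalg[OF _ meas])
  qed
  moreover have "AE z in N. real_cond_exp N (Uf (Suc k)) (X k) z = real_cond_exp N J (X k) z"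
    using \<open>?S \<subseteq> sets J\<close> by (intro Nn.real_cond_exp_null_completion[OF subalgebra_Uf JN _ Jnull int]) simp
  ultimately show "AE z in N. real_cond_exp N (Uf (Suc k)) (X k) z = X (Suc k) z"
    by eventually_elim simp
qed

lemma indep_vars_U: "prob_space.indep_vars N (\<lambda>_. borel) U UNIV"
proof -
  interpret Nn: prob_space N by (rule prob_space_N)
  have "Nn.indep_set (sets (Uf (Suc k))) (real_events N (U k))" for k
    using indep_Hp_U[of k] sets_Uf_subset_Hp[of "Suc k"] unfolding Nn.indep_sets2_eq by blast
  then show ?thesis by (rule Nn.indep_vars_if_indep_future[OF measurable_U])
qed

lemma path_law_N: "path_law N Vn En = L"
proof -
  have "path_law N Vn En = distr N L fst"
    unfolding path_law_def by (rule distr_cong) (auto simp: sets_L)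
  then show ?thesis by (simp add: distr_fst_N)
qed

end

section \<open>Random Euler paths\<close>

lemma (in prob_space) conditional_pmf_exists:
  fixes X :: "'a \<Rightarrow> 'b::countable"
  assumes X: "X \<in> measurable M (count_space UNIV)" and B: "B \<in> events" "prob B \<noteq> 0"
  shows "\<exists>q. \<forall>x. prob (B \<inter> {\<omega>\<in>space M. X \<omega> = x}) = pmf q x * prob B"
proof -
  have B0: "emeasure M B \<noteq> 0" "emeasure M B \<noteq> \<infinity>" using B by (auto simp: emeasure_eq_measure)
  interpret UB: prob_space "uniform_measure M B" by (rule prob_space_uniform_measure[OF B0])
  define \<mu> where "\<mu> = distr (uniform_measure M B) (count_space UNIV) X"
  have XU: "X \<in> measurable (uniform_measure M B) (count_space UNIV)" using X by simp
  interpret mu: prob_space \<mu> unfolding \<mu>_def by (rule UB.prob_space_distr[OF XU])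
  \<comment> \<open>To be a \<open>pmf\<close>, the conditional law must give almost every point
    positive mass. The points without mass form a countable union of null sets.\<close>
  have null: "(\<Union>x\<in>{x. measure \<mu> {x} = 0}. {x}) \<in> null_sets \<mu>"
    by (rule null_sets_UN') (auto simp: null_sets_def \<mu>_def mu.emeasure_eq_measure[unfolded \<mu>_def])
  have "AE x in \<mu>. x \<notin> (\<Union>x\<in>{x. measure \<mu> {x} = 0}. {x})" by (rule AE_not_in[OF null])
  then have "AE x in \<mu>. measure \<mu> {x} \<noteq> 0" by eventually_elim auto
  moreover have "sets \<mu> = UNIV" by (simp add: \<mu>_def)
  ultimately have q: "measure_pmf (Abs_pmf \<mu>) = \<mu>"
    using mu.prob_space_axioms by (intro Abs_pmf_inverse) simp
  have "prob (B \<inter> {\<omega>\<in>space M. X \<omega> = x}) = pmf (Abs_pmf \<mu>) x * prob B" for x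
  proof -
    have ev: "{\<omega>\<in>space M. X \<omega> = x} \<in> events"
      using measurable_sets[OF X, of "{x}"] by (simp add: vimage_def Int_def conj_commute)
    have "pmf (Abs_pmf \<mu>) x = measure \<mu> {x}" by (simp add: pmf.rep_eq q)
    also have "\<dots> = measure (uniform_measure M B) {\<omega>\<in>space M. X \<omega> = x}"
      unfolding \<mu>_def by (subst measure_distr[OF XU]) (auto intro!: arg_cong[where f="measure _"])
    also have "\<dots> = prob (B \<inter> {\<omega>\<in>space M. X \<omega> = x}) / prob B"
      by (rule measure_uniform_measure[OF B0 ev])
    finally show ?thesis using B by simp
  qed
  then show ?thesis by blast
qed

lemma Vgen_measurable_const:
  fixes r :: "'a \<Rightarrow> real"
  assumes r: "r \<in> borel_measurable (Vgen M V k)"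
    and "\<omega> \<in> space M" "\<omega>' \<in> space M" "V k \<omega> = V k \<omega>'"
  shows "r \<omega> = r \<omega>'"
proof -
  have "r -` {r \<omega>} \<inter> space (Vgen M V k) \<in> sets (Vgen M V k)" by (rule measurable_sets[OF r]) simp
  then obtain A where "r -` {r \<omega>} \<inter> space M = V k -` A \<inter> space M"
    by (auto simp: sets_Vgen nat_events_def)
  then show ?thesis using assms(2-) by (metis IntD1 IntI singletonD singletonI vimageE vimageI)
qed

text \<open>By \<open>cond\<close> the conditional probability of \<open>C\<close> given the whole
  past has a version that is a function of the vertex, hence equals a constant \<open>c\<close>
  where the vertex is \<open>u\<close>. Integrating over \<open>A\<close> intersected with that
  event gives the product.\<close>

lemma (in prob_space) cond_law_factor:
  assumes V: "\<And>j. V j \<in> measurable M (count_space UNIV)" and E: "\<And>j. E j \<in> measurable M (count_space UNIV)"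
    and C: "C \<in> events"
    and cond: "AE \<omega> in M. real_cond_exp M (Gfilt M V E (Suc k)) (indicator C) \<omega>
      = real_cond_exp M (Vgen M V (Suc k)) (indicator C) \<omega>"
  shows "\<exists>c. \<forall>A\<in>sets (Gfilt M V E (Suc k)).
    prob (A \<inter> {\<omega>\<in>space M. V (Suc k) \<omega> = u} \<inter> C) = c * prob (A \<inter> {\<omega>\<in>space M. V (Suc k) \<omega> = u})"
proof -
  let ?G = "Gfilt M V E (Suc k)" and ?B = "{\<omega>\<in>space M. V (Suc k) \<omega> = u}"
  define r where "r = real_cond_exp M (Vgen M V (Suc k)) (indicator C)"
  have G: "subalgebra M ?G" by (rule subalgebra_Gfilt[OF V E])
  interpret G: sigma_finite_subalgebra M ?G by (rule sigma_finite_subalgebraI[OF G])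
  have r: "r \<in> borel_measurable (Vgen M V (Suc k))" unfolding r_def by simp
  have "subalgebra M (Vgen M V (Suc k))"
    using V[of "Suc k"] by (simp add: subalgebra_def sets_Vgen nat_events_subset_iff)
  from measurable_from_subalg[OF this r] have rM [measurable]: "r \<in> borel_measurable M" .
  have "\<exists>c. \<forall>\<omega>\<in>?B. r \<omega> = c"
  proof (cases "?B = {}")
    case False
    then obtain \<omega>0 where "\<omega>0 \<in> ?B" by blast
    then show ?thesis using Vgen_measurable_const[OF r] by (intro exI[of _ "r \<omega>0"]) auto
  qed blast
  then obtain c where c: "\<And>\<omega>. \<omega> \<in> ?B \<Longrightarrow> r \<omega> = c" by blast
  have BG: "?B \<in> sets ?G"
  proof -
    have "V (Suc k) -` {u} \<inter> space ?G \<in> sets ?G"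
      by (rule measurable_sets[OF measurable_Gfilt(1)]) auto
    moreover have "V (Suc k) -` {u} \<inter> space ?G = ?B" by auto
    ultimately show ?thesis by simp
  qed
  have "prob (A \<inter> ?B \<inter> C) = c * prob (A \<inter> ?B)" if A: "A \<in> sets ?G" for A
  proof -
    have AB: "A \<inter> ?B \<in> sets ?G" using A BG by (rule sets.Int)
    then have ABM [measurable]: "A \<inter> ?B \<in> events" using G by (auto simp: subalgebra_def)
    have "prob (A \<inter> ?B \<inter> C) = (\<integral>\<omega>\<in>A \<inter> ?B. indicator C \<omega> \<partial>M)"
    proof -
      have "(\<integral>\<omega>\<in>A \<inter> ?B. indicat_real C \<omega> \<partial>M) = (\<integral>\<omega>. indicator (A \<inter> ?B \<inter> C) \<omega> \<partial>M)"
        unfolding set_lebesgue_integral_def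
        by (intro Bochner_Integration.integral_cong refl) (auto simp: indicator_def)
      then show ?thesis using ABM C by simp
    qed
    also have "\<dots> = (\<integral>\<omega>\<in>A \<inter> ?B. real_cond_exp M ?G (indicator C) \<omega> \<partial>M)"
      using C by (intro G.real_cond_exp_intA[OF _ AB]) (simp add: less_top[symmetric])
    also have "\<dots> = (\<integral>\<omega>. c * indicator (A \<inter> ?B) \<omega> \<partial>M)"
      unfolding set_lebesgue_integral_def
    proof (rule integral_cong_AE)
      show "AE \<omega> in M. indicat_real (A \<inter> ?B) \<omega> *\<^sub>R real_cond_exp M ?G (indicator C) \<omega> = c * indicat_real (A \<inter> ?B) \<omega>"
        using cond by eventually_elim (auto simp: indicator_def c r_def[symmetric])
    qed measurable
    also have "\<dots> = c * prob (A \<inter> ?B)" using ABM by simp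
    finally show ?thesis .
  qed
  then show ?thesis by blast
qed

lemma backward_chain_path_law:
  fixes M :: "'a measure" and V E :: "nat \<Rightarrow> 'a \<Rightarrow> nat"
  assumes path: "random_euler_path M V E"
    and erg: "ergodic_path M V E"
    and cond_law: "\<And>k x. AE \<omega> in M.
        real_cond_exp M (Gfilt M V E (Suc k)) (indicator {\<omega>\<in>space M. (V k \<omega>, E k \<omega>) = x} :: 'a \<Rightarrow> real) \<omega>
      = real_cond_exp M (Vgen M V (Suc k)) (indicator {\<omega>\<in>space M. (V k \<omega>, E k \<omega>) = x} :: 'a \<Rightarrow> real) \<omega>"
  shows "\<exists>p. backward_chain (path_law M V E) p"
proof -
  interpret prob_space M using path by (simp add: random_euler_path_def)
  have V [measurable]: "V k \<in> measurable M (count_space UNIV)"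
    and E [measurable]: "E k \<in> measurable M (count_space UNIV)" for k
    using path by (auto simp: random_euler_path_def)
  have edge: "AE \<omega> in M. \<forall>k. euler_edge k (V k \<omega>) (V (Suc k) \<omega>) (E k \<omega>)"
    using path by (simp add: random_euler_path_def euler_path_def)
  define X where "X k \<omega> = (V k \<omega>, E k \<omega>)" for k \<omega>
  have X [measurable]: "X k \<in> measurable M (count_space UNIV)" for k
    unfolding X_def
    by (rule measurable_compose_countable[OF _ V, where f="\<lambda>a \<omega>. (a, E k \<omega>)"])
      (rule measurable_compose[OF E], simp)
  define B where "B k u = {\<omega>\<in>space M. V (Suc k) \<omega> = u}" for k u
  define C where "C k x = {\<omega>\<in>space M. X k \<omega> = x}" for k x
  have Bev: "B k u \<in> events" for k u unfolding B_def by measurable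
  have Cev: "C k x \<in> events" for k x unfolding C_def by measurable
  have "\<exists>q. \<forall>x. prob (B k u \<inter> C k x) = pmf q x * prob (B k u)" if "prob (B k u) \<noteq> 0" for k u
    unfolding C_def by (rule conditional_pmf_exists[OF X Bev that])
  then obtain q where q: "\<And>k u x. prob (B k u) \<noteq> 0 \<Longrightarrow> prob (B k u \<inter> C k x) = pmf (q k u) x * prob (B k u)"
    by metis
  \<comment> \<open>No conditional law exists at a vertex of probability zero. The default stays at
    \<open>u\<close> when level \<open>k\<close> has such a vertex and descends by one otherwise, so
    that \<open>p_step\<close> holds for every \<open>u\<close> and \<open>p_level\<close> also at
    \<open>u = Suc k\<close>.\<close>
  define p where "p k u = (if prob (B k u) = 0 then return_pmf (if u \<le> k then u else u - 1, 0) else q k u)" for k u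
  have p: "prob (B k u \<inter> C k x) = pmf (p k u) x * prob (B k u)" for k u x
  proof (cases "prob (B k u) = 0")
    case True
    then have "prob (B k u \<inter> C k x) = 0"
      using finite_measure_mono[of "B k u \<inter> C k x" "B k u"] Bev by (simp add: measure_le_0_iff)
    then show ?thesis using True by simp
  qed (simp add: p_def q)
  have p_edge: "euler_edge k (fst x) u (snd x)" if x: "x \<in> set_pmf (p k u)" and u: "prob (B k u) \<noteq> 0" for k u x
  proof (rule ccontr)
    assume n: "\<not> euler_edge k (fst x) u (snd x)"
    have "AE \<omega> in M. \<omega> \<notin> B k u \<inter> C k x"
      using edge by eventually_elim (use n in \<open>auto simp: B_def C_def X_def\<close>)
    then have "prob (B k u \<inter> C k x) = 0"
      using Bev Cev by (subst prob_eq_0) auto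
    then show False using p[of k u x] u x by (simp add: set_pmf_iff)
  qed
  have p_def0: "set_pmf (p k u) = {(if u \<le> k then u else u - 1, 0)}" if "prob (B k u) = 0" for k u
    using that by (simp add: p_def)
  have markov: "prob (A \<inter> B k u \<inter> C k x) = pmf (p k u) x * prob (A \<inter> B k u)"
    if A: "A \<in> sets (Gfilt M V E (Suc k))" for A k u x
  proof (cases "prob (B k u) = 0")
    case True
    have "A \<in> events" using A subalgebra_Gfilt[of V M E, OF V E] by (auto simp: subalgebra_def)
    then have "prob (A \<inter> B k u \<inter> C k x) = 0" "prob (A \<inter> B k u) = 0"
      using finite_measure_mono[of "A \<inter> B k u \<inter> C k x" "B k u"] finite_measure_mono[of "A \<inter> B k u" "B k u"] Bev True
      by (auto simp: measure_le_0_iff)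
    then show ?thesis by simp
  next
    case False
    obtain c where c: "\<And>A. A \<in> sets (Gfilt M V E (Suc k)) \<Longrightarrow> prob (A \<inter> B k u \<inter> C k x) = c * prob (A \<inter> B k u)"
      using cond_law_factor[of V E, OF V E Cev[of k x], where k=k and u=u] cond_law[of k x]
      unfolding B_def C_def X_def by blast
    \<comment> \<open>Taking the whole space for \<open>A\<close> identifies \<open>c\<close> as the
      conditional probability already recorded in \<open>p k u\<close>.\<close>
    have "space M \<in> sets (Gfilt M V E (Suc k))" using sets.top[of "Gfilt M V E (Suc k)"] by simp
    from c[OF this] have "prob (B k u \<inter> C k x) = c * prob (B k u)"
      using sets.sets_into_space[OF Bev] by (simp add: Int_absorb1)
    then have "c = pmf (p k u) x" using p[of k u x] False by simp
    then show ?thesis using c[OF A] by simp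
  qed
  define \<pi> where "\<pi> \<omega> = (\<lambda>k. X k \<omega>)" for \<omega>
  let ?P = "PiM UNIV (\<lambda>_. count_space UNIV) :: (nat \<Rightarrow> nat \<times> nat) measure"
  have \<pi> [measurable]: "\<pi> \<in> measurable M ?P"
    unfolding \<pi>_def by (rule measurable_abs_UNIV) (rule X)
  define L where "L = path_law M V E"
  have L: "L = distr M ?P \<pi>" by (simp add: L_def path_law_def \<pi>_def[abs_def] X_def)
  have spL: "space L = UNIV" by (simp add: L space_PiM PiE_def)
  have setsL: "sets L = sets ?P" by (simp add: L)
  interpret L: prob_space L unfolding L by (rule prob_space_distr[OF \<pi>])
  have coord [measurable]: "(\<lambda>f. f k) \<in> measurable L (count_space UNIV)" for k
    using measurable_component_singleton[of k UNIV "\<lambda>_. count_space UNIV"]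
    by (simp add: measurable_cong_sets[OF setsL refl])
  have vertM: "vert k \<in> measurable L (count_space UNIV)" and labM: "lab k \<in> measurable L (count_space UNIV)" for k
    by (rule measurable_compose[OF coord], simp)+
  have \<pi>L: "\<pi> \<in> measurable M L" using \<pi> by (simp add: measurable_cong_sets[OF refl setsL])
  have probL: "L.prob S = prob (\<pi> -` S \<inter> space M)" if "S \<in> sets L" for S
    using that unfolding L by (subst measure_distr[OF \<pi>]) (auto simp: L)
  have AE_L: "AE f in L. S (f k) (f (Suc k))" if "AE \<omega> in M. S (X k \<omega>) (X (Suc k) \<omega>)" for S k
  proof -
    have "(\<lambda>f. S x (f (Suc k))) \<in> measurable L (count_space UNIV)" for x
      by (rule measurable_compose[OF coord]) simp
    from measurable_compose_countable[OF this coord]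
    have "(\<lambda>f. S (f k) (f (Suc k))) \<in> measurable L (count_space UNIV)" .
    then have "{f \<in> space ?P. S (f k) (f (Suc k))} \<in> sets ?P"
      using setsL sets_eq_imp_space_eq[OF setsL] by (simp add: pred_def)
    then show ?thesis using that unfolding L by (subst AE_distr_iff[OF \<pi>]) (auto simp: \<pi>_def)
  qed
  \<comment> \<open>Pulls events of the canonical path filtration back to that of \<open>M\<close>;
    both the Markov property and tail triviality are transferred through this.\<close>
  have into: "\<pi> -` A \<inter> space M \<in> sets (Gfilt M V E k)" if A: "A \<in> sets (Gfilt L vert lab k)" for A k
  proof -
    have "\<pi> \<in> measurable (Gfilt M V E k) (Gfilt L vert lab k)"
      by (rule measurable_into_Gfilt) (auto simp: \<pi>_def X_def spL intro: measurable_Gfilt)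
    from measurable_sets[OF this A] show ?thesis by simp
  qed
  have GL: "sets (Gfilt L vert lab k) \<subseteq> sets L" for k
    using subalgebra_Gfilt[of vert L lab, OF vertM labM] by (auto simp: subalgebra_def)
  have markovL: "L.prob (A \<inter> {f. f k = x \<and> vert (Suc k) f = u}) = pmf (p k u) x * L.prob (A \<inter> {f. vert (Suc k) f = u})"
    if A: "A \<in> sets (Gfilt L vert lab (Suc k))" for A k x u
  proof -
    have AL: "A \<in> sets L" using A GL by auto
    have "{f \<in> space L. f k = x \<and> vert (Suc k) f = u} \<in> sets L" "{f \<in> space L. vert (Suc k) f = u} \<in> sets L"
      using vertM by measurable
    then have "A \<inter> {f. f k = x \<and> vert (Suc k) f = u} \<in> sets L" "A \<inter> {f. vert (Suc k) f = u} \<in> sets L"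
      using AL by (auto simp: spL)
    moreover have "\<pi> -` (A \<inter> {f. f k = x \<and> vert (Suc k) f = u}) \<inter> space M = (\<pi> -` A \<inter> space M) \<inter> B k u \<inter> C k x"
      "\<pi> -` (A \<inter> {f. vert (Suc k) f = u}) \<inter> space M = (\<pi> -` A \<inter> space M) \<inter> B k u"
      by (auto simp: B_def C_def \<pi>_def X_def)
    ultimately show ?thesis using markov[OF into[OF A], of u x] by (simp add: probL)
  qed
  have "backward_chain L p"
  proof (unfold_locales)
    show "sets L = sets ?P" by (rule setsL)
    fix k u
    show "finite (set_pmf (p k u))"
    proof (cases "prob (B k u) = 0")
      case False
      \<comment> \<open>Both multiplicities, \<open>v + 1\<close> and \<open>k + 1 - v\<close>, are
        at most \<open>k + 1\<close> for \<open>v \<le> k\<close>, which bounds the copy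
        index.\<close>
      have "set_pmf (p k u) \<subseteq> {..k} \<times> {..Suc k}"
        using p_edge[OF _ False] by (fastforce simp: euler_edge_def)
      then show ?thesis by (rule finite_subset) simp
    qed (simp add: p_def0)
    show "fst x \<le> u \<and> u \<le> Suc (fst x)" if "x \<in> set_pmf (p k u)" for x
      using p_edge[OF that] p_def0[of k u] that by (cases "prob (B k u) = 0") (auto simp: euler_edge_def)
    show "fst x \<le> k" if "x \<in> set_pmf (p k u)" "u \<le> Suc k" for x
      using p_edge[OF that(1)] p_def0[of k u] that by (cases "prob (B k u) = 0") (auto simp: euler_edge_def split: if_splits)
    have "AE \<omega> in M. fst (X k \<omega>) \<le> k"
      using edge by eventually_elim (auto simp: X_def euler_edge_def)
    then show "AE f in L. vert k f \<le> k" by (rule AE_L[of "\<lambda>a _. fst a \<le> k"])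
    \<comment> \<open>Each pair of a vertex \<open>u\<close> and an edge \<open>x\<close> outside
      the support of \<open>p k u\<close> has probability zero by the Markov identity on the whole
      space, and there are countably many pairs.\<close>
    have "AE f in L. \<forall>x u. x \<notin> set_pmf (p k u) \<longrightarrow> \<not> (f k = x \<and> vert (Suc k) f = u)"
    proof (subst AE_all_countable, intro allI, subst AE_all_countable, intro allI)
      fix x u
      show "AE f in L. x \<notin> set_pmf (p k u) \<longrightarrow> \<not> (f k = x \<and> vert (Suc k) f = u)"
      proof (cases "x \<in> set_pmf (p k u)")
        case False
        have "L.prob {f. f k = x \<and> vert (Suc k) f = u} = 0"
          using markovL[of UNIV k x u] False sets.top[of "Gfilt L vert lab (Suc k)"]
          by (simp add: spL set_pmf_iff)
        moreover have "{f \<in> space L. f k = x \<and> vert (Suc k) f = u} \<in> sets L"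
          using vertM by measurable
        then have "{f. f k = x \<and> vert (Suc k) f = u} \<in> sets L" by (simp add: spL)
        ultimately have "AE f in L. f \<notin> {f. f k = x \<and> vert (Suc k) f = u}"
          using L.prob_eq_0 by blast
        then show ?thesis by eventually_elim simp
      qed simp
    qed
    then show "AE f in L. f k \<in> set_pmf (p k (vert (Suc k) f))" by eventually_elim blast
    show "L.prob (A \<inter> {f. f k = x \<and> vert (Suc k) f = u}) = pmf (p k u) x * L.prob (A \<inter> {f. vert (Suc k) f = u})"
      if "A \<in> sets (Gfilt L vert lab (Suc k))" for A x
      by (rule markovL[OF that])
  next
    fix A assume A: "\<And>k. A \<in> sets (Gfilt L vert lab k)"
    then have "A \<in> sets L" using GL by blast
    moreover have "\<forall>k. \<pi> -` A \<inter> space M \<in> sets (Gfilt M V E k)" using into A by blast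
    ultimately show "L.prob A = 0 \<or> L.prob A = 1"
      using erg by (simp add: ergodic_path_def probL)
  qed
  then show ?thesis unfolding L_def by blast
qed

text \<open>The space \<open>M\<close> may carry no randomness beyond the path, while the parameters
  use extra draws. Hence the conclusion concerns a copy with the same path law, realized as the
  first coordinate of the product of \<open>path_law M V E\<close> with the noise.\<close>

theorem theorem7p3:
  fixes M :: "'a measure" and V E :: "nat \<Rightarrow> 'a \<Rightarrow> nat"
  assumes path: "random_euler_path M V E"
    and erg: "ergodic_path M V E"
    and cond_law: "\<And>k x. AE \<omega> in M.
        real_cond_exp M (Gfilt M V E (Suc k)) (indicator {\<omega>\<in>space M. (V k \<omega>, E k \<omega>) = x} :: 'a \<Rightarrow> real) \<omega>
      = real_cond_exp M (Vgen M V (Suc k)) (indicator {\<omega>\<in>space M. (V k \<omega>, E k \<omega>) = x} :: 'a \<Rightarrow> real) \<omega>"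
  shows "(\<exists>(N :: cspace measure) V' E' U. prob_space N \<and>
            (\<forall>k. V' k \<in> measurable N (count_space UNIV) \<and> E' k \<in> measurable N (count_space UNIV)) \<and>
            path_law N V' E' = path_law M V E \<and>
            is_parameterization N V' E' U \<and> is_generating N V' E' U)
         \<and> standard_G M V E"
proof -
  obtain p where "backward_chain (path_law M V E) p"
    using backward_chain_path_law[OF assms] by blast
  then interpret backward_chain "path_law M V E" p .
  have "\<forall>k. Vn k \<in> measurable N (count_space UNIV) \<and> En k \<in> measurable N (count_space UNIV)"
    using measurable_Vn measurable_En by blast
  moreover have "\<forall>k. U k \<in> borel_measurable N" using measurable_U by blast
  ultimately show ?thesis
    unfolding standard_G_def
    using prob_space_N path_law_N parameterization generating indep_vars_U immersion
    by (intro conjI exI[of _ N] exI[of _ Vn] exI[of _ En] exI[of _ U]) auto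
qed

end
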